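(* There is a constant $A$ such that the following holds for all integers $n\ge 0$, $T\ge1$ and all $0\le p\le1$. Let $\mathcal C=\mathcal X_0^T$ be the classical circuit on one bit consisting of $T$ idle operations, and let $FT^n(\mathcal C)$ be its $n$-fold repeated fault-tolerant simulation. If $FT^n(\mathcal C)$ is subject to a $p$-bounded wire error model, then it simulates $\mathcal C$ with an $(Ap)^{2^n}$-bounded wire error model. Moreover, if the initial state $s(0)\in\{0^{3^n},1^{3^n}\}$ is an encoded logical state and $s(T)$ denotes the output state of $FT^n(\mathcal C)$, then $$\mathbb P\big(D_n(s(T))\ne D_n(s(0))\big)\le T\,(Ap)^{2^n}.$$
   Context: **Elementary gadgets** on a line of bits: $\mathcal X_0$ (one bit, identity); $\mathcal Y_0$ (two adjacent bits, swap); $\mathcal Z_0$ (three adjacent bits, replaces each of the three bits by the majority of the three). **Level-1 gadgets.** $\mathcal X_1$ acts on $3$ bits by $\mathcal X_0$ on each bit, with the same number of layers as $\mathcal Y_1$. $\mathcal Y_1$ acts on $6$ bits and swaps the first block of three with the second, bit by bit, by the diamond pattern of nearest-neighbour swaps on positions: layer 1: $(3,4)$; layer 2: $(2,3),(4,5)$; layer 3: $(1,2),(3,4),(5,6)$; layer 4: $(2,3),(4,5)$; layer 5: $(3,4)$; all other bits idle. $\mathcal Z_1$ acts on $9$ bits (three blocks of three): first a fixed five-layer circuit of nearest-neighbour swaps $\mathcal Y_0$ and idles $\mathcal X_0$ realizing the permutation sending the $j$-th bit of block $i$ to the $i$-th position of block $j$; then $\mathcal Z_0$ on each of the three blocks;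 then again a fixed five-layer circuit of swaps and idles realizing the same permutation. **Fault-tolerant simulation.** Let $EC_1=\mathcal Z_0$. For a circuit $\mathcal C$ of gadgets $\mathcal X_0,\mathcal Y_0,\mathcal Z_0$, $FT(\mathcal C)$ is obtained by replacing each bit by a block of $3$ bits and each gadget $\mathcal G_0$ by $\mathcal G_1$, with one layer of $EC_1$ gadgets (one per block) before the first layer of gates, between consecutive layers of gates, and after the last layer of gates. $FT^0(\mathcal C)=\mathcal C$ and $FT^n(\mathcal C)=FT(FT^{n-1}(\mathcal C))$. **Decoder.** $D_1(s_1,s_2,s_3)=\mathrm{Maj}(s_1,s_2,s_3)$, and $D_n$ on $3^n$ bits is $\mathrm{Maj}$ of $D_{n-1}$ of the three consecutive blocks of length $3^{n-1}$ ($D_0$ is the identity). **Wire error model.** A wire is the state of a bit at an input or output of an elementary gadget (a spacetime location between consecutive gadgets, including circuit inputs and outputs). Elementary gadgets act perfectly; noise acts by (arbitrarily) flipping bits on wires in a random set $E$ of wires. The model is $p$-bounded if $\mathbb P[W\subseteq E]\le p^{|W|}$ for every set $W$ of wires. **Simulates with a $q$-bounded wire error model** means: the value obtained by applying $D_n$ to the (noisy) output of $FT^n(\mathcal C)$ started from an encoded input equals the output of $\mathcal C$, started from the corresponding bit, subject to bit flips on wires of $\mathcal C$ contained in a random set $E'$ of wires of $\mathcal C$ with $\mathbb P[W\subseteq E']\le q^{|W|}$ for all sets $W$ of wires of $\mathcal C$. *)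

theory Defs
  imports "HOL-Probability.Probability_Mass_Function"
begin

section \<open>Circuits on a line of bits\<close>

datatype gadget = X0 | Y0 | Z0

fun arity :: "gadget \<Rightarrow> nat" where
  "arity X0 = 1"
| "arity Y0 = 2"
| "arity Z0 = 3"

definition maj :: "bool \<Rightarrow> bool \<Rightarrow> bool \<Rightarrow> bool" where
  "maj a b c \<longleftrightarrow> (a \<and> b) \<or> (a \<and> c) \<or> (b \<and> c)"

fun gadget_act :: "gadget \<Rightarrow> bool list \<Rightarrow> bool list" where
  "gadget_act X0 s = s"
| "gadget_act Y0 s = [s ! 1, s ! 0]"
| "gadget_act Z0 s = replicate 3 (maj (s ! 0) (s ! 1) (s ! 2))"

text \<open>A layer lists, from left to right, the gadgets tiling the line; idle bits carry an
  explicit \<open>X0\<close>. A circuit is the list of its layers in temporal order.\<close>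

type_synonym layer = "gadget list"
type_synonym circuit = "layer list"

definition layer_width :: "layer \<Rightarrow> nat" where
  "layer_width L = sum_list (map arity L)"

definition width :: "circuit \<Rightarrow> nat" where
  "width C = (if C = [] then 0 else layer_width (hd C))"

primrec apply_layer :: "layer \<Rightarrow> bool list \<Rightarrow> bool list" where
  "apply_layer [] s = []"
| "apply_layer (g # L) s = gadget_act g (take (arity g) s) @ apply_layer L (drop (arity g) s)"

definition run :: "circuit \<Rightarrow> bool list \<Rightarrow> bool list" where
  "run C s = fold apply_layer C s"


section \<open>Fault-tolerant simulation\<close>

definition Y1 :: circuit where
  "Y1 = [[X0, X0, Y0, X0, X0],
         [X0, Y0, Y0, X0],
         [Y0, Y0, Y0],
         [X0, Y0, Y0, X0],
         [X0, X0, Y0, X0, X0]]"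

definition X1 :: circuit where
  "X1 = replicate (length Y1) [X0, X0, X0]"

text \<open>The five-layer swap circuits used inside \<open>Z1\<close> are only determined through the
  permutation they realize, so they enter as parameters \<open>P\<close> (first) and \<open>Q\<close> (second)
  subject to the following condition. With bits numbered from 0, bit \<open>j\<close> of block \<open>i\<close> sits at
  position \<open>3 * i + j\<close>.\<close>

definition transposition_circuit :: "circuit \<Rightarrow> bool" where
  "transposition_circuit P \<longleftrightarrow>
     length P = 5 \<and>
     (\<forall>L \<in> set P. set L \<subseteq> {X0, Y0} \<and> layer_width L = 9) \<and>
     (\<forall>s. length s = 9 \<longrightarrow> (\<forall>i<3. \<forall>j<3. run P s ! (3 * j + i) = s ! (3 * i + j)))"

definition Z1 :: "circuit \<Rightarrow> circuit \<Rightarrow> circuit" where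
  "Z1 P Q = P @ [[Z0, Z0, Z0]] @ Q"

fun level1 :: "circuit \<Rightarrow> circuit \<Rightarrow> gadget \<Rightarrow> circuit" where
  "level1 P Q X0 = X1"
| "level1 P Q Y0 = Y1"
| "level1 P Q Z0 = Z1 P Q"

text \<open>Juxtaposition of circuits running side by side. Shorter ones are padded with idles;
  the padding never occurs for \<open>FT_pow P Q n (idle_circuit T)\<close> below, where no layer mixes
  \<open>Z0\<close> with other gadgets (lemma \<open>FT_pow_idle_homogeneous\<close>).\<close>

definition layer_at :: "circuit \<Rightarrow> nat \<Rightarrow> layer" where
  "layer_at C t = (if t < length C then C ! t else replicate (width C) X0)"

definition juxtapose :: "circuit list \<Rightarrow> circuit" where
  "juxtapose Cs =
     map (\<lambda>t. concat (map (\<lambda>C. layer_at C t) Cs)) [0..<foldr max (map length Cs) 0]"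

definition EC_layer :: "nat \<Rightarrow> layer" where
  "EC_layer w = replicate w Z0"

definition FT :: "circuit \<Rightarrow> circuit \<Rightarrow> circuit \<Rightarrow> circuit" where
  "FT P Q C =
     [EC_layer (width C)] @
     concat (map (\<lambda>L. juxtapose (map (level1 P Q) L) @ [EC_layer (width C)]) C)"

definition FT_pow :: "circuit \<Rightarrow> circuit \<Rightarrow> nat \<Rightarrow> circuit \<Rightarrow> circuit" where
  "FT_pow P Q n C = (FT P Q ^^ n) C"

definition idle_circuit :: "nat \<Rightarrow> circuit" where
  "idle_circuit T = replicate T [X0]"


section \<open>Encoding and decoding\<close>

fun decode :: "nat \<Rightarrow> bool list \<Rightarrow> bool" where
  "decode 0 s = s ! 0"
| "decode (Suc n) s =
     maj (decode n (take (3 ^ n) s))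
         (decode n (take (3 ^ n) (drop (3 ^ n) s)))
         (decode n (take (3 ^ n) (drop (2 * 3 ^ n) s)))"

definition encode_blocks :: "nat \<Rightarrow> bool list \<Rightarrow> bool list" where
  "encode_blocks n x = concat (map (replicate (3 ^ n)) x)"

definition decode_blocks :: "nat \<Rightarrow> nat \<Rightarrow> bool list \<Rightarrow> bool list" where
  "decode_blocks n w s = map (\<lambda>i. decode n (take (3 ^ n) (drop (i * 3 ^ n) s))) [0..<w]"


section \<open>Wire errors\<close>

text \<open>The wire \<open>(t, i)\<close> is bit \<open>i\<close> after \<open>t\<close> layers: an output of layer \<open>t\<close> and an input of
  layer \<open>t + 1\<close>. Wires with \<open>t = 0\<close> are the circuit inputs, those with \<open>t = length C\<close> the
  circuit outputs.\<close>

type_synonym wire = "nat \<times> nat"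

definition wires :: "circuit \<Rightarrow> wire set" where
  "wires C = {0..length C} \<times> {0..<width C}"

definition flip_at :: "wire set \<Rightarrow> nat \<Rightarrow> bool list \<Rightarrow> bool list" where
  "flip_at F t s = map (\<lambda>i. s ! i \<noteq> ((t, i) \<in> F)) [0..<length s]"

text \<open>\<open>noisy_run F t C s\<close> runs the layers \<open>C\<close>, the first of which is preceded by \<open>t\<close> others,
  flipping exactly the wires in \<open>F\<close>.\<close>

fun noisy_run :: "wire set \<Rightarrow> nat \<Rightarrow> circuit \<Rightarrow> bool list \<Rightarrow> bool list" where
  "noisy_run F t [] s = flip_at F t s"
| "noisy_run F t (L # C) s = noisy_run F (Suc t) C (apply_layer L (flip_at F t s))"

text \<open>Noise on \<open>E\<close> flips bits arbitrarily on the wires in \<open>E\<close>, i.e. it flips the wires of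
  some adversarially chosen \<open>F \<subseteq> E\<close>.\<close>

definition noisy_outputs :: "circuit \<Rightarrow> wire set \<Rightarrow> bool list \<Rightarrow> bool list set" where
  "noisy_outputs C E s = {noisy_run F 0 C s |F. F \<subseteq> E}"

text \<open>A random set of wires is given by its law. As there are finitely many wires, using
  \<open>pmf\<close> is no restriction; random variables on a common probability space are given by their
  joint law.\<close>

definition bounded_wire_errors :: "real \<Rightarrow> circuit \<Rightarrow> wire set pmf \<Rightarrow> bool" where
  "bounded_wire_errors p C \<E> \<longleftrightarrow>
     (\<forall>E \<in> set_pmf \<E>. E \<subseteq> wires C) \<and>
     (\<forall>W \<subseteq> wires C. measure_pmf.prob \<E> {E. W \<subseteq> E} \<le> p ^ card W)"

text \<open>\<open>J\<close> is the joint law of the error set \<open>E\<close> of the level-\<open>n\<close> simulation (of law \<open>\<E>\<close>) and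
  the error set \<open>E'\<close> of \<open>C\<close>.\<close>

definition simulates ::
  "circuit \<Rightarrow> circuit \<Rightarrow> nat \<Rightarrow> circuit \<Rightarrow> wire set pmf \<Rightarrow> real \<Rightarrow> bool" where
  "simulates P Q n C \<E> q \<longleftrightarrow>
     (\<exists>J :: (wire set \<times> wire set) pmf.
        map_pmf fst J = \<E> \<and>
        bounded_wire_errors q C (map_pmf snd J) \<and>
        (\<forall>(E, E') \<in> set_pmf J. \<forall>x. length x = width C \<longrightarrow>
           (\<forall>s \<in> noisy_outputs (FT_pow P Q n C) E (encode_blocks n x).
              decode_blocks n (width C) s \<in> noisy_outputs C E' x)))"


section \<open>Consistency of the definitions\<close>

lemma transposition_circuit_exists:
  "transposition_circuit
     [[X0, X0, Y0, X0, Y0, X0, X0],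
      [X0, Y0, Y0, X0, Y0, X0],
      [X0, X0, X0, X0, Y0, X0, X0, X0],
      [X0, X0, X0, Y0, Y0, X0, X0],
      [X0, X0, Y0, X0, X0, X0, X0, X0]]"
proof -
  let ?P = "[[X0, X0, Y0, X0, Y0, X0, X0],
      [X0, Y0, Y0, X0, Y0, X0],
      [X0, X0, X0, X0, Y0, X0, X0, X0],
      [X0, X0, X0, Y0, Y0, X0, X0],
      [X0, X0, Y0, X0, X0, X0, X0, X0]]"
  have less3: "(\<forall>i<3. R i) \<longleftrightarrow> R 0 \<and> R 1 \<and> R 2" for R :: "nat \<Rightarrow> bool"
    by (auto simp: numeral_3_eq_3 less_Suc_eq numeral_2_eq_2)
  have run: "run ?P [a, b, c, d, e, f, g, h, i] = [a, d, g, b, e, h, c, f, i]"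
    for a b c d e f g h i
    by (simp add: run_def)
  have "\<forall>i<3. \<forall>j<3. run ?P s ! (3 * j + i) = s ! (3 * i + j)" if s: "length s = 9" for s
  proof -
    have "s = map ((!) s) [0..<9]"
      by (metis map_nth s)
    also have "\<dots> = [s ! 0, s ! 1, s ! 2, s ! 3, s ! 4, s ! 5, s ! 6, s ! 7, s ! 8]"
      by (simp add: upt_rec numeral_eq_Suc)
    finally have "run ?P s = [s ! 0, s ! 3, s ! 6, s ! 1, s ! 4, s ! 7, s ! 2, s ! 5, s ! 8]"
      using run by metis
    then show ?thesis by (simp add: less3 numeral_2_eq_2)
  qed
  moreover have "\<forall>L \<in> set ?P. set L \<subseteq> {X0, Y0} \<and> layer_width L = 9"
    by (simp add: layer_width_def)
  ultimately show ?thesis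
    unfolding transposition_circuit_def by simp
qed

definition homogeneous :: "layer \<Rightarrow> bool" where
  "homogeneous L \<longleftrightarrow> set L \<subseteq> {Z0} \<or> set L \<subseteq> {X0, Y0}"

lemma set_juxtapose_level1:
  assumes P: "\<forall>L \<in> set P. set L \<subseteq> {X0, Y0}" and Q: "\<forall>L \<in> set Q. set L \<subseteq> {X0, Y0}"
    and L: "homogeneous L" and K: "K \<in> set (juxtapose (map (level1 P Q) L))"
  shows "homogeneous K"
proof -
  obtain t where K': "K = concat (map (\<lambda>g. layer_at (level1 P Q g) t) L)"
    using K by (auto simp: juxtapose_def o_def)
  have X: "set (layer_at X1 t) \<subseteq> {X0, Y0}"
    by (auto simp: layer_at_def X1_def)
  have Y: "set (layer_at Y1 t) \<subseteq> {X0, Y0}"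
  proof (cases "t < length Y1")
    case True
    then have "Y1 ! t \<in> set Y1" by simp
    then have "set (Y1 ! t) \<subseteq> {X0, Y0}" unfolding Y1_def by fastforce
    then show ?thesis using True by (simp add: layer_at_def)
  qed (auto simp: layer_at_def)
  have Z: "homogeneous (layer_at (Z1 P Q) t)"
  proof (cases "t < length (Z1 P Q)")
    case True
    then have "Z1 P Q ! t \<in> set (Z1 P Q)" by (rule nth_mem)
    then have "homogeneous (Z1 P Q ! t)"
      using P Q by (auto simp: Z1_def homogeneous_def)
    then show ?thesis using True by (simp add: layer_at_def)
  qed (auto simp: layer_at_def homogeneous_def)
  from L consider "set L \<subseteq> {Z0}" | "set L \<subseteq> {X0, Y0}"
    by (auto simp: homogeneous_def)
  then show ?thesis
  proof cases
    case 1
    then have "set K \<subseteq> set (layer_at (Z1 P Q) t)"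
      unfolding K' by auto
    then show ?thesis using Z unfolding homogeneous_def by blast
  next
    case 2
    have "set (layer_at (level1 P Q g) t) \<subseteq> {X0, Y0}" if "g \<in> set L" for g
      using 2 that X Y by (cases g) auto
    then have "set K \<subseteq> {X0, Y0}"
      unfolding K' by auto
    then show ?thesis unfolding homogeneous_def by blast
  qed
qed

lemma FT_pow_idle_homogeneous:
  assumes "transposition_circuit P" "transposition_circuit Q"
    and "L \<in> set (FT_pow P Q n (idle_circuit T))"
  shows "homogeneous L"
  using assms(3)
proof (induction n arbitrary: L)
  case 0
  then show ?case by (auto simp: FT_pow_def idle_circuit_def homogeneous_def)
next
  case (Suc n)
  let ?C = "FT_pow P Q n (idle_circuit T)"
  have PQ: "\<forall>L \<in> set P. set L \<subseteq> {X0, Y0}" "\<forall>L \<in> set Q. set L \<subseteq> {X0, Y0}"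
    using assms(1,2) by (auto simp: transposition_circuit_def)
  have EC: "homogeneous (EC_layer w)" for w
    by (auto simp: EC_layer_def homogeneous_def)
  have "L \<in> set (FT P Q ?C)"
    using Suc.prems by (simp add: FT_pow_def)
  then have "L = EC_layer (width ?C) \<or>
      (\<exists>K \<in> set ?C. L \<in> set (juxtapose (map (level1 P Q) K)))"
    by (auto simp: FT_def split: if_splits)
  then show ?case
    using EC set_juxtapose_level1[OF PQ] Suc.IH by blast
qed

end

theory Submission
  imports Defs
begin

text \<open>All gadgets are monotone and self-dual, so one may assume that the encoded bit is \<open>0\<close> and that
  every faulty wire is set to \<open>1\<close>; this replaces the adversary by a deterministic process.
  For that process each level of encoding reduces an error set \<open>E\<close> on \<open>FT C\<close> to an error set \<open>E'\<close>
  on \<open>C\<close> in which every wire is charged to two faults of \<open>E\<close> of its own, located near it.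
  A majority gadget whose inputs disagree may have all its outputs corrupted by two faults; then
  one of its inputs is declared faulty instead, at the same price of two faults.
  As only boundedly many pairs can be charged to a given wire, a \<open>p\<close>-bounded model becomes
  \<open>(K p)\<^sup>2\<close>-bounded, and \<open>n\<close> reductions give the exponent \<open>2 ^ n\<close>.\<close>


section \<open>Monotone noise\<close>

text \<open>\<open>simulates\<close> fixes \<open>E'\<close> before the input and before the flips
  are chosen. Here \<open>E'\<close> is made a function of \<open>E\<close> alone: the OR process is
  the worst case over all flips inside \<open>E\<close> and, by self-duality, over both logical
  bits. Levels and layers can be treated separately because an error-correction layer always emits
  exact codewords: the past survives only in the decoded bits, and faults fall into disjoint time
  windows, one per simulated layer. The obstacle is that the exponent doubles only if pairs charged
  to different wires are disjoint. For swap circuits, disjoint space-time paths ensure this. In the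
  majority gadget every output block takes one bit from each of three internal majorities, so two
  wrong majorities spoil all three outputs; if the inputs already disagree, each of these majorities
  costs a single fault, too little to pay for three output wires. For the idle circuit itself only
  the nonemptiness of \<open>E'\<close> matters, since one flip anywhere on the single bit inverts
  the output.\<close>

definition or_at :: "wire set \<Rightarrow> nat \<Rightarrow> bool list \<Rightarrow> bool list" where
  "or_at E t s = map (\<lambda>i. s ! i \<or> (t, i) \<in> E) [0..<length s]"

fun or_run :: "wire set \<Rightarrow> nat \<Rightarrow> circuit \<Rightarrow> bool list \<Rightarrow> bool list" where
  "or_run E t [] s = or_at E t s"
| "or_run E t (L # C) s = or_run E (Suc t) C (apply_layer L (or_at E t s))"

abbreviation le_bits :: "bool list \<Rightarrow> bool list \<Rightarrow> bool" (infix "\<sqsubseteq>" 50) where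
  "s \<sqsubseteq> s' \<equiv> list_all2 (\<longrightarrow>) s s'"

definition has_width :: "nat \<Rightarrow> circuit \<Rightarrow> bool" where
  "has_width w C \<longleftrightarrow> (\<forall>L \<in> set C. layer_width L = w)"

lemma has_width_simps [simp]:
  "has_width w []"
  "has_width w (L # C) \<longleftrightarrow> layer_width L = w \<and> has_width w C"
  "has_width w (C @ D) \<longleftrightarrow> has_width w C \<and> has_width w D"
  by (auto simp: has_width_def)

lemma layer_width_simps [simp]:
  "layer_width [] = 0"
  "layer_width (g # L) = arity g + layer_width L"
  "layer_width (L @ M) = layer_width L + layer_width M"
  "layer_width (replicate k g) = k * arity g"
  by (simp_all add: layer_width_def sum_list_replicate)

lemma length_flip_at [simp]: "length (flip_at F t s) = length s"
  by (simp add: flip_at_def)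

lemma length_or_at [simp]: "length (or_at E t s) = length s"
  by (simp add: or_at_def)

lemma nth_or_at [simp]: "i < length s \<Longrightarrow> or_at E t s ! i \<longleftrightarrow> s ! i \<or> (t, i) \<in> E"
  by (simp add: or_at_def)

lemma length_gadget_act: "length s = arity g \<Longrightarrow> length (gadget_act g s) = arity g"
  by (cases g) auto

lemma length_apply_layer:
  "length s = layer_width L \<Longrightarrow> length (apply_layer L s) = layer_width L"
  by (induction L arbitrary: s) (auto simp: length_gadget_act)

lemma length_noisy_run: "has_width (length s) C \<Longrightarrow> length (noisy_run F t C s) = length s"
  by (induction C arbitrary: s t) (auto simp: length_apply_layer)

lemma length_or_run: "has_width (length s) C \<Longrightarrow> length (or_run E t C s) = length s"
  by (induction C arbitrary: s t) (auto simp: length_apply_layer)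

lemma length_fold_apply_layer:
  "has_width (length s) C \<Longrightarrow> length (fold apply_layer C s) = length s"
  by (induction C arbitrary: s) (auto simp: length_apply_layer)

text \<open>A run makes the wires at both of its ends noisy, so two runs are joined across a layer;
  joined directly, they would share the wires at the seam. This is also why consecutive pieces have
  disjoint fault windows.\<close>

lemma or_run_append:
  "or_run E t (C @ L # D) s = or_run E (t + Suc (length C)) D (apply_layer L (or_run E t C s))"
  by (induction C arbitrary: s t) auto

lemma apply_layer_append:
  "length s = layer_width L \<Longrightarrow> apply_layer (L @ M) (s @ s') = apply_layer L s @ apply_layer M s'"
  by (induction L arbitrary: s) auto

section \<open>Monotonicity of noisy runs\<close>

lemma gadget_act_mono:
  "s \<sqsubseteq> s' \<Longrightarrow> length s = arity g \<Longrightarrow> gadget_act g s \<sqsubseteq> gadget_act g s'"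
  by (cases g; simp)
     (auto simp: list_all2_conv_all_nth maj_def nth_Cons less_Suc_eq_0_disj split: nat.splits)

lemma apply_layer_mono:
  "s \<sqsubseteq> s' \<Longrightarrow> length s = layer_width L \<Longrightarrow> apply_layer L s \<sqsubseteq> apply_layer L s'"
  by (induction L arbitrary: s s')
     (auto intro!: list_all2_appendI gadget_act_mono list_all2_takeI list_all2_dropI)

text \<open>The initial states are compared only after the noise at time \<open>t\<close>. An error
  already present in \<open>s\<close> may therefore be matched by a faulty wire of \<open>E'\<close>
  at that time, which is how corrupted decoded bits become entries of a new error set.\<close>

lemma or_run_mono:
  assumes "has_width (length s) C" "or_at E t s \<sqsubseteq> or_at E' t s'" "E \<subseteq> E'"
  shows "or_run E t C s \<sqsubseteq> or_run E' t C s'"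
  using assms
proof (induction C arbitrary: s s' t)
  case (Cons L C)
  let ?r = "apply_layer L (or_at E t s)" and ?r' = "apply_layer L (or_at E' t s')"
  have "?r \<sqsubseteq> ?r'"
    using Cons.prems by (intro apply_layer_mono) auto
  then have "or_at E (Suc t) ?r \<sqsubseteq> or_at E' (Suc t) ?r'"
    using Cons.prems(3) by (auto simp: list_all2_conv_all_nth)
  moreover have "length ?r = length s"
    using Cons.prems(1) by (simp add: length_apply_layer)
  ultimately show ?case
    using Cons.prems by (simp add: Cons.IH)
qed simp

lemma noisy_run_le_or_run:
  assumes "has_width (length s) C" "s \<sqsubseteq> s'" "F \<subseteq> E"
  shows "noisy_run F t C s \<sqsubseteq> or_run E t C s'"
  using assms
proof (induction C arbitrary: s s' t)
  case Nil
  then show ?case by (auto simp: list_all2_conv_all_nth flip_at_def)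
next
  case (Cons L C)
  have "flip_at F t s \<sqsubseteq> or_at E t s'"
    using Cons.prems by (auto simp: list_all2_conv_all_nth flip_at_def)
  then have "apply_layer L (flip_at F t s) \<sqsubseteq> apply_layer L (or_at E t s')"
    using Cons.prems by (intro apply_layer_mono) auto
  then show ?case
    using Cons by (simp add: length_apply_layer)
qed

section \<open>Self-duality\<close>

lemma gadget_act_Not:
  "length s = arity g \<Longrightarrow> gadget_act g (map Not s) = map Not (gadget_act g s)"
  by (cases g) (auto simp: maj_def)

lemma apply_layer_Not:
  "length s = layer_width L \<Longrightarrow> apply_layer L (map Not s) = map Not (apply_layer L s)"
  by (induction L arbitrary: s) (auto simp: gadget_act_Not take_map drop_map)

lemma flip_at_Not: "flip_at F t (map Not s) = map Not (flip_at F t s)"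
  by (auto simp: flip_at_def)

lemma noisy_run_Not:
  "has_width (length s) C \<Longrightarrow> noisy_run F t C (map Not s) = map Not (noisy_run F t C s)"
  by (induction C arbitrary: s t) (auto simp: flip_at_Not apply_layer_Not length_apply_layer)

section \<open>The decoder is monotone and self-dual\<close>

lemma decode_mono:
  "s \<sqsubseteq> s' \<Longrightarrow> length s = 3 ^ n \<Longrightarrow> decode n s \<longrightarrow> decode n s'"
proof (induction n arbitrary: s s')
  case 0
  then show ?case by (auto simp: list_all2_conv_all_nth)
next
  case (Suc n)
  have *: "decode n (take (3 ^ n) (drop k s)) \<longrightarrow> decode n (take (3 ^ n) (drop k s'))"
    if "k \<le> 2 * 3 ^ n" for k
    using Suc.prems that by (intro Suc.IH list_all2_takeI list_all2_dropI) auto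
  show ?case
    using *[of 0] *[of "3 ^ n"] *[of "2 * 3 ^ n"] by (auto simp: maj_def)
qed

lemma decode_Not: "length s = 3 ^ n \<Longrightarrow> decode n (map Not s) \<longleftrightarrow> \<not> decode n s"
proof (induction n arbitrary: s)
  case (Suc n)
  have "decode n (take (3 ^ n) (drop k (map Not s))) \<longleftrightarrow> \<not> decode n (take (3 ^ n) (drop k s))"
    if "k \<le> 2 * 3 ^ n" for k
    using Suc.prems that by (simp add: take_map drop_map Suc.IH)
  from this[of 0] this[of "3 ^ n"] this[of "2 * 3 ^ n"] show ?case
    by (auto simp: maj_def)
qed simp

lemma decode_replicate: "decode n (replicate (3 ^ n) b) = b"
  by (induction n) (auto simp: maj_def)


section \<open>One level of encoding\<close>

lemma encode_blocks_1_simps [simp]: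
  "encode_blocks (Suc 0) [] = []"
  "encode_blocks (Suc 0) (b # x) = b # b # b # encode_blocks (Suc 0) x"
  "encode_blocks (Suc 0) (x @ y) = encode_blocks (Suc 0) x @ encode_blocks (Suc 0) y"
  by (simp_all add: encode_blocks_def numeral_3_eq_3)

lemma length_encode_blocks_1 [simp]: "length (encode_blocks (Suc 0) x) = 3 * length x"
  by (induction x) auto

lemma encode_blocks_1_nth:
  "i < length x \<Longrightarrow> j < 3 \<Longrightarrow> encode_blocks (Suc 0) x ! (3 * i + j) = x ! i"
proof (induction x arbitrary: i)
  case (Cons b x)
  then show ?case
    by (cases i) (auto simp: nth_Cons numeral_3_eq_3 less_Suc_eq)
qed simp

lemma length_decode_blocks [simp]: "length (decode_blocks n w s) = w"
  by (simp add: decode_blocks_def)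

lemma decode_blocks_1_nth:
  assumes "i < w" "length s = 3 * w"
  shows "decode_blocks (Suc 0) w s ! i = maj (s ! (3 * i)) (s ! (3 * i + 1)) (s ! (3 * i + 2))"
  using assms by (simp add: decode_blocks_def algebra_simps)

text \<open>\<open>decode\<close> splits off the coarsest blocks, whereas undoing the outermost
  \<open>FT\<close> decodes the finest blocks of three. The two orders agree because decoding the
  finest blocks acts on each third of the word separately.\<close>

lemma decode_Suc:
  assumes "length s = 3 ^ Suc n"
  shows "decode (Suc n) s = decode n (decode_blocks (Suc 0) (3 ^ n) s)"
  using assms
proof (induction n arbitrary: s)
  case 0
  then show ?case by (simp add: decode_blocks_def numeral_2_eq_2)
next
  case (Suc n)
  have "decode (Suc n) (take (3 ^ Suc n) (drop (k * 3 ^ Suc n) s))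
      = decode n (take (3 ^ n) (drop (k * 3 ^ n) (decode_blocks (Suc 0) (3 ^ Suc n) s)))"
    if "k \<le> 2" for k
  proof -
    have k: "k * 3 ^ n + 3 ^ n \<le> 3 ^ Suc n"
      using mult_right_mono[OF that, of "3 ^ n"] by simp
    have "k * 3 ^ Suc n + 3 ^ Suc n \<le> length s"
      using k Suc.prems by simp
    then have len: "length (take (3 ^ Suc n) (drop (k * 3 ^ Suc n) s)) = 3 ^ Suc n"
      unfolding length_take length_drop by linarith
    then have "decode (Suc n) (take (3 ^ Suc n) (drop (k * 3 ^ Suc n) s))
      = decode n (decode_blocks (Suc 0) (3 ^ n) (take (3 ^ Suc n) (drop (k * 3 ^ Suc n) s)))"
      by (intro Suc.IH) simp
    also have "decode_blocks (Suc 0) (3 ^ n) (take (3 ^ Suc n) (drop (k * 3 ^ Suc n) s))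
      = take (3 ^ n) (drop (k * 3 ^ n) (decode_blocks (Suc 0) (3 ^ Suc n) s))"
      (is "?l = ?r")
    proof (rule nth_equalityI)
      show "length ?l = length ?r"
        unfolding length_take length_drop length_decode_blocks using k by linarith
    next
      fix i assume "i < length ?l"
      then have i: "i < 3 ^ n" by simp
      have ki: "k * 3 ^ n + i < 3 ^ Suc n"
        using i k by linarith
      have "?l ! i = maj (s ! (k * 3 ^ Suc n + 3 * i)) (s ! (k * 3 ^ Suc n + 3 * i + 1))
          (s ! (k * 3 ^ Suc n + 3 * i + 2))"
        using i len by (subst decode_blocks_1_nth) (auto simp: add.assoc)
      also have "\<dots> = decode_blocks (Suc 0) (3 ^ Suc n) s ! (k * 3 ^ n + i)"
        using Suc.prems by (subst decode_blocks_1_nth[OF ki]) (auto simp: algebra_simps)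
      also have "\<dots> = ?r ! i"
        using i ki by (simp del: power_Suc)
      finally show "?l ! i = ?r ! i" .
    qed
    finally show ?thesis .
  qed
  from this[of 0] this[of 1] this[of 2] show ?case
    by (simp only: decode.simps(2)[of "Suc n"] decode.simps(2)[of n s for s]) simp
qed

text \<open>Whatever word enters, codewords leave. This decouples successive simulated layers, and
  it also handles the middle layer of \<open>Z1\<close>, which has the same form.\<close>

lemma apply_EC_layer:
  "length s = 3 * w \<Longrightarrow>
    apply_layer (EC_layer w) s = encode_blocks (Suc 0) (decode_blocks (Suc 0) w s)"
proof (induction w arbitrary: s)
  case 0
  then show ?case by (simp add: EC_layer_def decode_blocks_def)
next
  case (Suc w)
  then obtain a b c s' where s: "s = a # b # c # s'" "length s' = 3 * w"
    by (auto simp: length_Suc_conv numeral_3_eq_3)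
  have "decode_blocks (Suc 0) (Suc w) s = maj a b c # decode_blocks (Suc 0) w s'"
    unfolding s(1) decode_blocks_def
    by (simp add: upt_conv_Cons map_Suc_upt[symmetric] o_def numeral_3_eq_3 numeral_2_eq_2 
      del: upt_Suc)
  then show ?case
    using Suc.IH[OF s(2)] by (simp add: s(1) EC_layer_def numeral_3_eq_3 numeral_2_eq_2)
qed


section \<open>Swap circuits\<close>

text \<open>Each output bit of a circuit of swaps is the disjunction of one input bit and of the noise
  along its own space-time path. Noise on different paths cannot interact, and this is what keeps
  the fault sets blamed for different logical errors disjoint.\<close>

lemma swap_layer:
  assumes "set L \<subseteq> {X0, Y0}"
  obtains \<pi> where "inj_on \<pi> {..<layer_width L}"
    "\<And>k. k < layer_width L \<Longrightarrow> \<pi> k < layer_width L \<and> k \<le> \<pi> k + 1 \<and> \<pi> k \<le> k + 1"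
    "\<And>s k. length s = layer_width L \<Longrightarrow> k < layer_width L \<Longrightarrow> apply_layer L s ! k = s ! \<pi> k"
proof -
  have "\<exists>\<pi>. inj_on \<pi> {..<layer_width L} \<and>
    (\<forall>k < layer_width L. \<pi> k < layer_width L \<and> k \<le> \<pi> k + 1 \<and> \<pi> k \<le> k + 1 \<and>
      (\<forall>s. length s = layer_width L \<longrightarrow> apply_layer L s ! k = s ! \<pi> k))"
    using assms
  proof (induction L)
    case (Cons g L)
    have "set L \<subseteq> {X0, Y0}" using Cons.prems by simp
    from Cons.IH[OF this] obtain \<pi> where IH: "inj_on \<pi> {..<layer_width L} \<and>
      (\<forall>k < layer_width L. \<pi> k < layer_width L \<and> k \<le> \<pi> k + 1 \<and> \<pi> k \<le> k + 1 \<and>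
        (\<forall>s. length s = layer_width L \<longrightarrow> apply_layer L s ! k = s ! \<pi> k))"
      ..
    then have inj: "inj_on \<pi> {..<layer_width L}" and
      \<pi>: "\<And>k. k < layer_width L \<Longrightarrow> \<pi> k < layer_width L \<and> k \<le> \<pi> k + 1 \<and> \<pi> k \<le> k + 1"
      and nth: "\<And>k s. k < layer_width L \<Longrightarrow> length s = layer_width L \<Longrightarrow> apply_layer L s ! k = s ! \<pi> k"
      by blast+
    define a where "a = arity g"
    \<comment> \<open>\<open>a - 1 - k\<close> reverses the first \<open>a\<close> positions: the
      identity for \<open>X0\<close>, the swap for \<open>Y0\<close>.\<close>
    define \<rho> where "\<rho> k = (if k < a then a - 1 - k else a + \<pi> (k - a))" for k
    have ar: "arity g = a"
      by (simp add: a_def)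
    have a: "a = 1 \<and> g = X0 \<or> a = 2 \<and> g = Y0"
      using Cons.prems by (auto simp: a_def)
    have "inj_on \<rho> {..<layer_width (g # L)}"
    proof (rule inj_onI)
      fix k k' assume k: "k \<in> {..<layer_width (g # L)}" "k' \<in> {..<layer_width (g # L)}" "\<rho> k = \<rho> k'"
      have "k - a = k' - a" if "a \<le> k" "a \<le> k'"
      proof (rule inj_onD[OF inj])
        show "\<pi> (k - a) = \<pi> (k' - a)" using k(3) that by (simp add: \<rho>_def)
        show "k - a \<in> {..<layer_width L}" "k' - a \<in> {..<layer_width L}"
          using k(1,2) that by (simp_all add: ar)
      qed
      then show "k = k'"
        using k(3) unfolding \<rho>_def by (cases "k < a"; cases "k' < a"; simp)
    qed
    moreover have "\<rho> k < layer_width (g # L) \<and> k \<le> \<rho> k + 1 \<and> \<rho> k \<le> k + 1"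
      if "k < layer_width (g # L)" for k
    proof (cases "k < a")
      case True
      then show ?thesis using that a by (auto simp: \<rho>_def)
    next
      case False
      then have "k - a < layer_width L" using that by (simp add: ar)
      from \<pi>[OF this] False show ?thesis by (simp add: \<rho>_def ar) linarith
    qed
    moreover have "apply_layer (g # L) s ! k = s ! \<rho> k"
      if "k < layer_width (g # L)" "length s = layer_width (g # L)" for k s
    proof (cases "k < a")
      case True
      then show ?thesis
        using a that by (auto simp: \<rho>_def nth_append less_2_cases_iff)
    next
      case False
      then have "apply_layer L (drop a s) ! (k - a) = drop a s ! \<pi> (k - a)"
        using that by (intro nth) (simp_all add: ar)
      moreover have "length (gadget_act g (take a s)) = a"
        using that length_gadget_act[of "take a s" g] by (simp add: ar)
      ultimately show ?thesis
        using False that by (simp add: \<rho>_def ar nth_append)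
    qed
    ultimately show ?case by (intro exI[of _ \<rho>]) simp
  qed simp
  then show ?thesis using that by blast
qed

definition swap_circuit :: "nat \<Rightarrow> circuit \<Rightarrow> bool" where
  "swap_circuit w D \<longleftrightarrow> has_width w D \<and> (\<forall>L \<in> set D. set L \<subseteq> {X0, Y0})"

lemma swap_circuit_paths:
  assumes "swap_circuit w D"
  obtains \<sigma> Path where
    "inj_on \<sigma> {..<w}"
    "\<And>k. k < w \<Longrightarrow> \<sigma> k < w \<and> k \<le> \<sigma> k + length D \<and> \<sigma> k \<le> k + length D"
    "\<And>k. k < w \<Longrightarrow> Path k \<subseteq> {t..t + length D} \<times> {k - length D..k + length D}"
    "\<And>k l. k < w \<Longrightarrow> l < w \<Longrightarrow> k \<noteq> l \<Longrightarrow> Path k \<inter> Path l = {}"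
    "\<And>s k. length s = w \<Longrightarrow> k < w \<Longrightarrow> fold apply_layer D s ! k = s ! \<sigma> k"
    "\<And>E s k. length s = w \<Longrightarrow> k < w \<Longrightarrow> or_run E t D s ! k \<longleftrightarrow> s ! \<sigma> k \<or> E \<inter> Path k \<noteq> {}"
  using assms
proof (induction D arbitrary: t thesis)
  case Nil
  show ?case
    by (rule Nil(1)[of id "\<lambda>k. {(t, k)}"]) auto
next
  case (Cons L D)
  have L: "set L \<subseteq> {X0, Y0}" and w: "layer_width L = w" and D: "swap_circuit w D"
    using Cons.prems(2) by (auto simp: swap_circuit_def)
  obtain \<pi> where \<pi>: "inj_on \<pi> {..<w}"
    "\<And>k. k < w \<Longrightarrow> \<pi> k < w \<and> k \<le> \<pi> k + 1 \<and> \<pi> k \<le> k + 1"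
    "\<And>s k. length s = w \<Longrightarrow> k < w \<Longrightarrow> apply_layer L s ! k = s ! \<pi> k"
    by (rule swap_layer[OF L, unfolded w]) (rule that)
  obtain \<sigma> Path where IH:
    "inj_on \<sigma> {..<w}"
    "\<And>k. k < w \<Longrightarrow> \<sigma> k < w \<and> k \<le> \<sigma> k + length D \<and> \<sigma> k \<le> k + length D"
    "\<And>k. k < w \<Longrightarrow> Path k \<subseteq> {Suc t..Suc t + length D} \<times> {k - length D..k + length D}"
    "\<And>k l. k < w \<Longrightarrow> l < w \<Longrightarrow> k \<noteq> l \<Longrightarrow> Path k \<inter> Path l = {}"
    "\<And>s k. length s = w \<Longrightarrow> k < w \<Longrightarrow> fold apply_layer D s ! k = s ! \<sigma> k"
    "\<And>E s k. length s = w \<Longrightarrow> k < w \<Longrightarrow>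
       or_run E (Suc t) D s ! k \<longleftrightarrow> s ! \<sigma> k \<or> E \<inter> Path k \<noteq> {}"
    by (rule Cons.IH[OF _ D, of "Suc t"]) (rule that)
  have inj: "inj_on (\<pi> \<circ> \<sigma>) {..<w}"
    using IH(1,2) \<pi>(1) by (auto intro!: comp_inj_on intro: inj_on_subset)
  have len: "length (apply_layer L s) = w" if "length s = w" for s
    using that w length_apply_layer by simp
  show ?case
  \<comment> \<open>Each path is extended backwards by the wire it occupies at time
    \<open>t\<close>. These new wires differ for different outputs by injectivity of
    \<open>\<pi> \<circ> \<sigma>\<close>, and they cannot meet the old paths, which start at time
    \<open>Suc t\<close>.\<close>
  proof (rule Cons.prems(1)[of "\<pi> \<circ> \<sigma>" "\<lambda>k. insert (t, \<pi> (\<sigma> k)) (Path k)"])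
    fix k assume k: "k < w"
    show *: "(\<pi> \<circ> \<sigma>) k < w \<and> k \<le> (\<pi> \<circ> \<sigma>) k + length (L # D) \<and> (\<pi> \<circ> \<sigma>) k \<le> k + length (L # D)"
      using IH(2)[OF k] \<pi>(2)[of "\<sigma> k"] by auto
    show "insert (t, \<pi> (\<sigma> k)) (Path k) \<subseteq>
        {t..t + length (L # D)} \<times> {k - length (L # D)..k + length (L # D)}"
      using IH(3)[OF k] * by fastforce
  next
    fix k l assume "k < w" "l < w" "k \<noteq> l"
    then show "insert (t, \<pi> (\<sigma> k)) (Path k) \<inter> insert (t, \<pi> (\<sigma> l)) (Path l) = {}"
      using IH(3)[of k] IH(3)[of l] IH(4)[of k l] inj_onD[OF inj, of k l] by auto
  next
    fix s :: "bool list" and k assume "length s = w" "k < w"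
    then show "fold apply_layer (L # D) s ! k = s ! (\<pi> \<circ> \<sigma>) k"
      using IH(2,5) \<pi>(3) len by simp
  next
    fix E and s :: "bool list" and k assume "length s = w" "k < w"
    then show "or_run E t (L # D) s ! k \<longleftrightarrow>
        s ! (\<pi> \<circ> \<sigma>) k \<or> E \<inter> insert (t, \<pi> (\<sigma> k)) (Path k) \<noteq> {}"
      using IH(2,6) \<pi>(2,3) len by auto
  qed (rule inj)
qed

text \<open>With the source bit replaced by the noiseless output, only the ideal action of the
  circuit has to be known, not the route of each bit.\<close>

lemma swap_circuit_or_run:
  assumes "swap_circuit w D"
  obtains Path where
    "\<And>k. k < w \<Longrightarrow> Path k \<subseteq> {t..t + length D} \<times> {k - length D..k + length D}"
    "\<And>k l. k < w \<Longrightarrow> l < w \<Longrightarrow> k \<noteq> l \<Longrightarrow> Path k \<inter> Path l = {}"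
    "\<And>E s k. length s = w \<Longrightarrow> k < w \<Longrightarrow>
       or_run E t D s ! k \<longleftrightarrow> fold apply_layer D s ! k \<or> E \<inter> Path k \<noteq> {}"
proof -
  obtain \<sigma> Path where
    "inj_on \<sigma> {..<w}"
    "\<And>k. k < w \<Longrightarrow> \<sigma> k < w \<and> k \<le> \<sigma> k + length D \<and> \<sigma> k \<le> k + length D"
    and *: "\<And>k. k < w \<Longrightarrow> Path k \<subseteq> {t..t + length D} \<times> {k - length D..k + length D}"
    "\<And>k l. k < w \<Longrightarrow> l < w \<Longrightarrow> k \<noteq> l \<Longrightarrow> Path k \<inter> Path l = {}"
    "\<And>s k. length s = w \<Longrightarrow> k < w \<Longrightarrow> fold apply_layer D s ! k = s ! \<sigma> k"
    "\<And>E s k. length s = w \<Longrightarrow> k < w \<Longrightarrow> or_run E t D s ! k \<longleftrightarrow> s ! \<sigma> k \<or> E \<inter> Path k \<noteq> {}"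
    by (rule swap_circuit_paths[OF assms, of t]) (rule that)
  show ?thesis
    by (rule that[OF *(1,2)]) (simp_all add: *(3,4))
qed


section \<open>Charging errors to pairs of faults\<close>

text \<open>\<open>bool\<close> serves as a two-element index set: a single injectivity condition
  says both that a wire gets two distinct faults and that different wires get disjoint
  pairs.\<close>

definition explained :: "(wire \<Rightarrow> wire set) \<Rightarrow> wire set \<Rightarrow> wire set \<Rightarrow> bool" where
  "explained N E E' \<longleftrightarrow> (\<exists>h :: wire \<times> bool \<Rightarrow> wire.
     inj_on h (E' \<times> UNIV) \<and> (\<forall>w \<in> E'. \<forall>b. h (w, b) \<in> E \<inter> N w))"

lemma explained_mono: "explained N E E' \<Longrightarrow> E \<subseteq> F \<Longrightarrow> explained N F E'"
  unfolding explained_def by blast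

text \<open>Only the fault sets have to be disjoint. A wire in both \<open>E'\<close> and
  \<open>F'\<close>, such as one blamed as output of a layer and as input of the next, keeps its
  pair from \<open>E\<close>.\<close>

lemma explained_Un:
  assumes "explained N E E'" "explained N F F'" "E \<inter> F = {}"
  shows "explained N (E \<union> F) (E' \<union> F')"
proof -
  obtain h :: "wire \<times> bool \<Rightarrow> wire" where h: "inj_on h (E' \<times> UNIV)" "\<forall>w \<in> E'. \<forall>b. h (w, b) \<in> E \<inter> N w"
    using assms(1) unfolding explained_def by blast
  obtain h' :: "wire \<times> bool \<Rightarrow> wire" where h': "inj_on h' (F' \<times> UNIV)" "\<forall>w \<in> F'. \<forall>b. h' (w, b) \<in> F \<inter> N w"
    using assms(2) unfolding explained_def by blast
  let ?g = "\<lambda>(w, b). if w \<in> E' then h (w, b) else h' (w, b)"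
  have "inj_on ?g ((E' \<union> F') \<times> UNIV)"
  proof (rule inj_onI)
    fix x y assume *: "x \<in> (E' \<union> F') \<times> UNIV" "y \<in> (E' \<union> F') \<times> UNIV" "?g x = ?g y"
    obtain w b v c where xy: "x = (w, b)" "y = (v, c)" by fastforce
    show "x = y"
    proof (cases "w \<in> E' \<longleftrightarrow> v \<in> E'")
      case True
      then show ?thesis
        using * inj_onD[OF h(1), of x y] inj_onD[OF h'(1), of x y]
        by (simp add: xy split: if_splits)
    next
      case False
      then have "?g x \<in> E \<and> ?g y \<in> F \<or> ?g x \<in> F \<and> ?g y \<in> E"
        using *(1,2) h(2) h'(2) by (cases "v \<in> E'") (simp_all add: xy)
      then have "?g y \<in> E \<inter> F"
        unfolding *(3) by (elim disjE conjE) (rule IntI; assumption)+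
      with assms(3) show ?thesis by (simp only: empty_iff)
    qed
  qed
  moreover have "\<forall>w \<in> E' \<union> F'. \<forall>b. ?g (w, b) \<in> (E \<union> F) \<inter> N w"
    using h(2) h'(2) by auto
  ultimately show ?thesis
    unfolding explained_def by blast
qed

text \<open>Inside a group every fault is near every blamed wire, so counting suffices and no
  individual matching has to be exhibited. The sets \<open>A g\<close> may overlap;
  \<open>\<gamma>\<close> assigns each wire to one group.\<close>

lemma explained_groups:
  assumes "\<And>g. g \<in> G \<Longrightarrow> finite (A g) \<and> finite (H g) \<and> 2 * card (A g) \<le> card (H g)"
    and "\<And>g. g \<in> G \<Longrightarrow> H g \<subseteq> E"
    and "\<And>g w. g \<in> G \<Longrightarrow> w \<in> A g \<Longrightarrow> H g \<subseteq> N w"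
    and "\<And>g g'. g \<in> G \<Longrightarrow> g' \<in> G \<Longrightarrow> g \<noteq> g' \<Longrightarrow> H g \<inter> H g' = {}"
  shows "explained N E (\<Union>g \<in> G. A g)"
proof -
  have "\<exists>h. h ` (A g \<times> (UNIV :: bool set)) \<subseteq> H g \<and> inj_on h (A g \<times> UNIV)" if "g \<in> G" for g
    using assms(1)[OF that] by (intro card_le_inj) (auto simp: card_cartesian_product)
  then obtain h where h: "\<And>g. g \<in> G \<Longrightarrow> h g ` (A g \<times> (UNIV :: bool set)) \<subseteq> H g"
      "\<And>g. g \<in> G \<Longrightarrow> inj_on (h g) (A g \<times> UNIV)"
    by metis
  obtain \<gamma> where \<gamma>: "\<And>w. w \<in> (\<Union>g \<in> G. A g) \<Longrightarrow> \<gamma> w \<in> G \<and> w \<in> A (\<gamma> w)"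
    by (metis UN_E)
  let ?h = "\<lambda>(w, b). h (\<gamma> w) (w, b)"
  have hH: "h (\<gamma> w) (w, b) \<in> H (\<gamma> w)" if "w \<in> (\<Union>g \<in> G. A g)" for w b
    using h(1) \<gamma>[OF that] by fastforce
  have "inj_on ?h ((\<Union>g \<in> G. A g) \<times> UNIV)"
  proof (rule inj_onI)
    fix x y assume *: "x \<in> (\<Union>g \<in> G. A g) \<times> UNIV" "y \<in> (\<Union>g \<in> G. A g) \<times> UNIV" "?h x = ?h y"
    obtain w b v c where xy: "x = (w, b)" "y = (v, c)" by fastforce
    have wv: "w \<in> (\<Union>g \<in> G. A g)" "v \<in> (\<Union>g \<in> G. A g)" using * xy by auto
    have "\<gamma> w = \<gamma> v"
      using assms(4)[of "\<gamma> w" "\<gamma> v"] hH[OF wv(1), of b] hH[OF wv(2), of c] \<gamma>[OF wv(1)] \<gamma>[OF wv(2)] *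
      by (auto simp: xy)
    then show "x = y"
      using * inj_onD[OF h(2)[of "\<gamma> w"], of x y] \<gamma>[OF wv(1)] \<gamma>[OF wv(2)] by (auto simp: xy)
  qed
  moreover have "?h (w, b) \<in> E \<inter> N w" if "w \<in> (\<Union>g \<in> G. A g)" for w b
    using hH[OF that, of b] \<gamma>[OF that] assms(2)[of "\<gamma> w"] assms(3)[of "\<gamma> w" w] by auto
  ultimately show ?thesis
    unfolding explained_def by (intro exI[of _ ?h]) blast
qed

text \<open>Disjointness is what turns the number of paths hit into a lower bound for the number of
  faults: no fault is counted for two paths.\<close>

lemma card_hits_le:
  assumes "finite K" "finite (\<Union>k \<in> K. H k)"
    and "\<And>k l. k \<in> K \<Longrightarrow> l \<in> K \<Longrightarrow> k \<noteq> l \<Longrightarrow> H k \<inter> H l = {}"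
  shows "(\<Sum>k \<in> K. of_bool (H k \<noteq> {})) \<le> card (\<Union>k \<in> K. H k)"
proof -
  have "(\<Sum>k \<in> K. of_bool (H k \<noteq> {})) \<le> (\<Sum>k \<in> K. card (H k))"
    using assms(1,2) by (intro sum_mono) (auto simp: card_gt_0_iff Suc_le_eq)
  also have "\<dots> = card (\<Union>k \<in> K. H k)"
    using assms by (intro card_UN_disjoint[symmetric]) auto
  finally show ?thesis .
qed


section \<open>Level-1 gadgets side by side\<close>

text \<open>The number of layers is a parameter, so that the empty list yields \<open>n\<close>
  empty layers and inductions over the list of gadgets can start there; \<open>juxtapose []\<close>
  has no layers at all.\<close>

definition side_by_side :: "nat \<Rightarrow> circuit list \<Rightarrow> circuit" where
  "side_by_side n Cs = map (\<lambda>t. concat (map (\<lambda>C. C ! t) Cs)) [0..<n]"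

lemma length_side_by_side [simp]: "length (side_by_side n Cs) = n"
  by (simp add: side_by_side_def)

lemma side_by_side_Nil: "side_by_side n [] = replicate n []"
  by (simp add: side_by_side_def map_replicate_const)

lemma side_by_side_Cons:
  "length C = n \<Longrightarrow> side_by_side n (C # Cs) = map2 (@) C (side_by_side n Cs)"
  by (rule nth_equalityI) (auto simp: side_by_side_def)

lemma juxtapose_eq_side_by_side:
  assumes "Cs \<noteq> []" "\<forall>C \<in> set Cs. length C = n"
  shows "juxtapose Cs = side_by_side n Cs"
proof -
  have "foldr max (map length Cs) 0 = n"
    using assms
  proof (induction Cs)
    case (Cons C Cs)
    then show ?case by (cases Cs) auto
  qed simp
  then show ?thesis
    using assms(2) unfolding juxtapose_def side_by_side_def
    by (auto intro!: arg_cong[where f = concat] simp: layer_at_def)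
qed

lemma fold_apply_layer_map2:
  assumes "length C = length D" "has_width (length s) C"
  shows "fold apply_layer (map2 (@) C D) (s @ s') = fold apply_layer C s @ fold apply_layer D s'"
  using assms
  by (induction C D arbitrary: s s' rule: list_induct2)
     (auto simp: apply_layer_append length_apply_layer)

lemma swap_circuit_map2:
  assumes "length C = length D" "swap_circuit a C" "swap_circuit b D"
  shows "swap_circuit (a + b) (map2 (@) C D)"
  using assms
  by (induction C D rule: list_induct2) (auto simp: swap_circuit_def)

lemma funpow_apply_layer_Nil: "(apply_layer [] ^^ n) [] = []"
  by (induction n) auto

lemma level1_swap_gadget:
  assumes "g \<in> {X0, Y0}"
  shows "length (level1 P Q g) = 5" "swap_circuit (3 * arity g) (level1 P Q g)"
    and "length x = arity g \<Longrightarrow>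
      fold apply_layer (level1 P Q g) (encode_blocks (Suc 0) x) = encode_blocks (Suc 0) (gadget_act g x)"
proof -
  have g: "g = X0 \<or> g = Y0"
    using assms by simp
  then show "length (level1 P Q g) = 5"
    by (elim disjE) (simp_all add: X1_def Y1_def)
  show "swap_circuit (3 * arity g) (level1 P Q g)"
    using g by (elim disjE) (simp_all add: X1_def Y1_def swap_circuit_def has_width_def)
  show "fold apply_layer (level1 P Q g) (encode_blocks (Suc 0) x) = encode_blocks (Suc 0) (gadget_act g x)"
    if "length x = arity g"
    using g
  proof
    assume g: "g = X0"
    with that obtain a where "x = [a]"
      by (auto simp: length_Suc_conv)
    then show ?thesis
      by (simp add: g X1_def Y1_def numeral_eq_Suc)
  next
    assume g: "g = Y0"
    with that obtain a b where "x = [a, b]"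
      by (auto simp: length_Suc_conv numeral_2_eq_2)
    then show ?thesis
      by (simp add: g Y1_def)
  qed
qed

lemma level1_swap_layer:
  assumes "set L \<subseteq> {X0, Y0}"
  shows "swap_circuit (3 * layer_width L) (side_by_side 5 (map (level1 P Q) L))"
    and "length x = layer_width L \<Longrightarrow>
      fold apply_layer (side_by_side 5 (map (level1 P Q) L)) (encode_blocks (Suc 0) x)
        = encode_blocks (Suc 0) (apply_layer L x)"
proof -
  have "swap_circuit (3 * layer_width L) (side_by_side 5 (map (level1 P Q) L)) \<and>
    (\<forall>x. length x = layer_width L \<longrightarrow>
      fold apply_layer (side_by_side 5 (map (level1 P Q) L)) (encode_blocks (Suc 0) x)
        = encode_blocks (Suc 0) (apply_layer L x))"
    using assms
  proof (induction L)
    case Nil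
    then show ?case
      by (simp add: side_by_side_Nil funpow_apply_layer_Nil swap_circuit_def has_width_def)
  next
    case (Cons g L)
    let ?D = "side_by_side 5 (map (level1 P Q) L)"
    have g: "g \<in> {X0, Y0}" and L: "set L \<subseteq> {X0, Y0}"
      using Cons.prems by auto
    note l = level1_swap_gadget[OF g, where P = P and Q = Q]
    have eq: "side_by_side 5 (map (level1 P Q) (g # L)) = map2 (@) (level1 P Q g) ?D"
      using l(1) by (simp add: side_by_side_Cons)
    have "swap_circuit (3 * layer_width (g # L)) (map2 (@) (level1 P Q g) ?D)"
      using swap_circuit_map2[OF _ l(2), of ?D] Cons.IH[OF L] l(1) by (simp add: add_mult_distrib2)
    moreover have "fold apply_layer (map2 (@) (level1 P Q g) ?D) (encode_blocks (Suc 0) x)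
        = encode_blocks (Suc 0) (apply_layer (g # L) x)" if x: "length x = layer_width (g # L)" for x
    proof -
      have "encode_blocks (Suc 0) x =
          encode_blocks (Suc 0) (take (arity g) x) @ encode_blocks (Suc 0) (drop (arity g) x)"
        by (simp flip: encode_blocks_1_simps(3))
      then show ?thesis
        using x l Cons.IH[OF L] by (simp add: fold_apply_layer_map2 swap_circuit_def)
    qed
    ultimately show ?case unfolding eq by blast
  qed
  then show "swap_circuit (3 * layer_width L) (side_by_side 5 (map (level1 P Q) L))"
    and "length x = layer_width L \<Longrightarrow>
      fold apply_layer (side_by_side 5 (map (level1 P Q) L)) (encode_blocks (Suc 0) x)
        = encode_blocks (Suc 0) (apply_layer L x)"
    by blast+
qed

lemma transposition_swap_circuit:
  assumes "transposition_circuit P"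
  shows "length P = 5" "swap_circuit 9 P"
  using assms by (auto simp: transposition_circuit_def swap_circuit_def has_width_def)

text \<open>In group \<open>g\<close> the transposition leaves in every block \<open>a\<close> one
  bit from each of the three code blocks \<open>3 * g + b\<close>. Hence a majority taken within
  block \<open>a\<close> is a majority of the three encoded bits.\<close>

lemma transposition_copies:
  assumes P: "transposition_circuit P"
  shows "swap_circuit (9 * m) (side_by_side 5 (replicate m P))"
    and "length v = 3 * m \<Longrightarrow> g < m \<Longrightarrow> a < 3 \<Longrightarrow> b < 3 \<Longrightarrow>
      fold apply_layer (side_by_side 5 (replicate m P)) (encode_blocks (Suc 0) v) ! (9 * g + 3 * a + b)
        = v ! (3 * g + b)"
proof (induction m arbitrary: v g)
  case 0
  {
    case 1
    show ?case by (simp add: side_by_side_Nil swap_circuit_def has_width_def)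
  next
    case 2
    then show ?case by simp
  }
next
  case (Suc m)
  let ?D = "side_by_side 5 (replicate m P)"
  note l = transposition_swap_circuit[OF P]
  have eq: "side_by_side 5 (replicate (Suc m) P) = map2 (@) P ?D"
    using l(1) by (simp add: side_by_side_Cons)
  {
    case 1
    show ?case
      unfolding eq using swap_circuit_map2[OF _ l(2) Suc.IH(1)] l(1) by simp
  next
    case 2
    have v: "encode_blocks (Suc 0) v =
        encode_blocks (Suc 0) (take 3 v) @ encode_blocks (Suc 0) (drop 3 v)"
      by (simp flip: encode_blocks_1_simps(3))
    have len: "length (encode_blocks (Suc 0) (take 3 v)) = 9"
      using 2 by simp
    have w: "has_width 9 P"
      using l(2) by (simp add: swap_circuit_def)
    have fold: "fold apply_layer (map2 (@) P ?D) (encode_blocks (Suc 0) v) =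
        fold apply_layer P (encode_blocks (Suc 0) (take 3 v)) @
        fold apply_layer ?D (encode_blocks (Suc 0) (drop 3 v))"
      unfolding v using l(1) w len by (intro fold_apply_layer_map2) simp_all
    have len': "length (fold apply_layer P (encode_blocks (Suc 0) (take 3 v))) = 9"
      using length_fold_apply_layer[of "encode_blocks (Suc 0) (take 3 v)" P] w len by simp
    show ?case
    proof (cases g)
      case 0
      have "run P (encode_blocks (Suc 0) (take 3 v)) ! (3 * a + b) =
          encode_blocks (Suc 0) (take 3 v) ! (3 * b + a)"
        using P len 2(3,4) by (simp add: transposition_circuit_def)
      also have "\<dots> = v ! b"
        using 2 by (simp add: encode_blocks_1_nth)
      finally show ?thesis
        unfolding eq fold using 2(3,4) by (simp add: nth_append len' 0 run_def)
    next
      case (Suc g')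
      have "fold apply_layer ?D (encode_blocks (Suc 0) (drop 3 v)) ! (9 * g' + 3 * a + b) =
          drop 3 v ! (3 * g' + b)"
        using 2 Suc by (intro Suc.IH(2)) simp_all
      also have "\<dots> = v ! (3 * g + b)"
        using 2 Suc by (simp add: algebra_simps)
      finally show ?thesis
        unfolding eq fold using 2(3,4) by (simp add: nth_append len' Suc add.assoc)
    qed
  }
qed

lemma level1_maj_layer:
  assumes "length P = 5" "length Q = 5"
  shows "side_by_side 11 (replicate m (Z1 P Q)) =
    side_by_side 5 (replicate m P) @ EC_layer (3 * m) # side_by_side 5 (replicate m Q)"
proof (induction m)
  case 0
  show ?case by (simp add: side_by_side_Nil EC_layer_def numeral_eq_Suc)
next
  case (Suc m)
  have "EC_layer (3 * Suc m) = [Z0, Z0, Z0] @ EC_layer (3 * m)"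
    by (simp add: EC_layer_def numeral_3_eq_3)
  moreover have "length (Z1 P Q) = 11"
    using assms by (simp add: Z1_def)
  ultimately show ?case
    using assms Suc by (simp add: side_by_side_Cons Z1_def)
qed


section \<open>Faults inside one simulated layer\<close>

text \<open>One wrong bit does not change the decoded value of a block, so a wrong output block has
  hits on two of its three paths, hence two faults. Distinct blocks own distinct paths, so every
  wrong output wire can be charged to faults of its own.\<close>

lemma swap_stage:
  assumes D: "swap_circuit (3 * w) D" "length D \<le> 5"
    and v: "length v = w" "length y = w"
      "fold apply_layer D (encode_blocks (Suc 0) v) = encode_blocks (Suc 0) y"
    and N: "\<And>i. i < w \<Longrightarrow> {t..t + length D} \<times> {3 * i - 20..3 * i + 20} \<subseteq> N (t', i)"
  obtains R where "R \<subseteq> {..<w}" "explained N (E \<inter> {t..t + length D} \<times> UNIV) ({t'} \<times> R)"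
    "decode_blocks (Suc 0) w (or_run E t D (encode_blocks (Suc 0) v)) \<sqsubseteq> map (\<lambda>i. y ! i \<or> i \<in> R) [0..<w]"
proof -
  obtain Path where Path:
    "\<And>k. k < 3 * w \<Longrightarrow> Path k \<subseteq> {t..t + length D} \<times> {k - length D..k + length D}"
    "\<And>k l. k < 3 * w \<Longrightarrow> l < 3 * w \<Longrightarrow> k \<noteq> l \<Longrightarrow> Path k \<inter> Path l = {}"
    "\<And>E s k. length s = 3 * w \<Longrightarrow> k < 3 * w \<Longrightarrow>
       or_run E t D s ! k \<longleftrightarrow> fold apply_layer D s ! k \<or> E \<inter> Path k \<noteq> {}"
    by (rule swap_circuit_or_run[OF D(1), of t]) (rule that)
  define K where "K i = {3 * i, 3 * i + 1, 3 * i + (2 :: nat)}" for i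
  define H where "H i = (\<Union>k \<in> K i. E \<inter> Path k)" for i
  define R where "R = {i. i < w \<and> 2 \<le> card (H i)}"
  have K: "k < 3 * w \<and> 3 * i \<le> k \<and> k \<le> 3 * i + 2" if "k \<in> K i" "i < w" for k i
    using that by (auto simp: K_def)
  have H: "H i \<subseteq> E \<inter> {t..t + length D} \<times> {3 * i - 20..3 * i + 20}" if "i < w" for i
  proof -
    have "Path k \<subseteq> {t..t + length D} \<times> {3 * i - 20..3 * i + 20}" if "k \<in> K i" for k
      using K[OF that \<open>i < w\<close>] D(2) by (intro order.trans[OF Path(1)]) auto
    then show ?thesis by (auto simp: H_def)
  qed
  have fin: "finite (H i)" if "i < w" for i
    using H[OF that] by (rule finite_subset) auto
  have disj: "H i \<inter> H i' = {}" if "i < w" "i' < w" "i \<noteq> i'" for i i'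
  proof -
    have "Path k \<inter> Path k' = {}" if "k \<in> K i" "k' \<in> K i'" for k k'
      using K[OF that(1)] K[OF that(2)] \<open>i < w\<close> \<open>i' < w\<close> \<open>i \<noteq> i'\<close> by (intro Path(2)) auto
    then show ?thesis unfolding H_def by blast
  qed
  have "explained N (E \<inter> {t..t + length D} \<times> UNIV) (\<Union>i \<in> R. {(t', i)})"
  proof (rule explained_groups[where H = H])
    fix i w' assume "i \<in> R" "w' \<in> {(t', i)}"
    then show "H i \<subseteq> N w'"
      using H[of i] N[of i] by (auto simp: R_def)
  next
    fix i assume "i \<in> R"
    then show "H i \<subseteq> E \<inter> {t..t + length D} \<times> UNIV"
      using H[of i] by (auto simp: R_def)
  qed (use fin disj in \<open>auto simp: R_def\<close>)
  then have "explained N (E \<inter> {t..t + length D} \<times> UNIV) ({t'} \<times> R)"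
    by (simp add: Sigma_def)
  moreover have "y ! i \<or> i \<in> R"
    if i: "i < w" and dec: "decode_blocks (Suc 0) w (or_run E t D (encode_blocks (Suc 0) v)) ! i" for i
  proof (rule ccontr)
    assume not: "\<not> (y ! i \<or> i \<in> R)"
    \<comment> \<open>The noiseless run puts the value of \<open>y ! i\<close> on all three bits of
      block \<open>i\<close>. As this value is 0, ones in the block can only come from hits.\<close>
    have out: "or_run E t D (encode_blocks (Suc 0) v) ! (3 * i + j) \<longleftrightarrow> E \<inter> Path (3 * i + j) \<noteq> {}"
      if "j < 3" for j
      using that i not v by (subst Path(3)) (auto simp: encode_blocks_1_nth)
    have "has_width (length (encode_blocks (Suc 0) v)) D"
      using D(1) v(1) by (simp add: swap_circuit_def)
    then have len: "length (or_run E t D (encode_blocks (Suc 0) v)) = 3 * w"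
      using v(1) by (simp add: length_or_run)
    have "(\<Sum>k \<in> K i. of_bool (E \<inter> Path k \<noteq> {})) \<le> card (H i)"
      unfolding H_def
    proof (rule card_hits_le)
      show "finite (K i)" by (simp add: K_def)
      show "finite (\<Union>k \<in> K i. E \<inter> Path k)" using fin[OF i] by (simp add: H_def)
      show "E \<inter> Path k \<inter> (E \<inter> Path l) = {}" if "k \<in> K i" "l \<in> K i" "k \<noteq> l" for k l
        using Path(2)[of k l] K[OF that(1) i] K[OF that(2) i] that(3) by blast
    qed
    moreover have "maj (E \<inter> Path (3 * i) \<noteq> {}) (E \<inter> Path (3 * i + 1) \<noteq> {}) (E \<inter> Path (3 * i + 2) \<noteq> {})"
      using dec out[of 0] out[of 1] out[of 2] i len by (simp add: decode_blocks_1_nth)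
    then have "(\<Sum>k \<in> K i. of_bool (E \<inter> Path k \<noteq> {})) \<ge> (2 :: nat)"
      by (simp only: maj_def, elim disjE) (simp_all add: K_def del: sum_of_bool_eq)
    ultimately show False
      using not i by (simp add: R_def)
  qed
  ultimately show ?thesis
    by (intro that[of R]) (auto simp: R_def list_all2_conv_all_nth)
qed

text \<open>The point of the transposed majority gadget: two hits suffice to corrupt several output blocks
  at once only if the inputs disagree. In that case the blame is put on a single input, which is
  what keeps two hits per blamed wire.\<close>

lemma majority_gadget_blame:
  fixes v u :: "nat \<Rightarrow> bool" and p q :: "nat \<Rightarrow> nat \<Rightarrow> bool"
  assumes le: "\<And>i. i < 3 \<Longrightarrow> v i \<Longrightarrow> u i"
  defines "M \<equiv> \<lambda>j. maj (v 0 \<or> p j 0) (v 1 \<or> p j 1) (v 2 \<or> p j 2)"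
  defines "out \<equiv> \<lambda>i. maj (M 0 \<or> q i 0) (M 1 \<or> q i 1) (M 2 \<or> q i 2)"
  obtains I R :: "nat set" where "I \<subseteq> {..<3}" "R \<subseteq> {..<3}"
    "2 * (card I + card R) \<le> (\<Sum>a<3. \<Sum>b<3. of_bool (p a b) + of_bool (q a b))"
    "\<And>i. i < 3 \<Longrightarrow> out i \<Longrightarrow> maj (u 0 \<or> 0 \<in> I) (u 1 \<or> 1 \<in> I) (u 2 \<or> 2 \<in> I) \<or> i \<in> R"
proof -
  define S :: nat where "S = (\<Sum>a<3. \<Sum>b<3. of_bool (p a b) + of_bool (q a b))"
  define c :: nat where "c = of_bool (M 0) + of_bool (M 1) + of_bool (M 2)"
  define \<alpha> :: "nat \<Rightarrow> nat" where "\<alpha> j = of_bool (p j 0) + of_bool (p j 1) + of_bool (p j 2)" for j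
  define \<beta> :: "nat \<Rightarrow> nat" where "\<beta> i = of_bool (q i 0) + of_bool (q i 1) + of_bool (q i 2)" for i
  have S: "S = \<alpha> 0 + \<alpha> 1 + \<alpha> 2 + \<beta> 0 + \<beta> 1 + \<beta> 2"
    by (simp add: S_def \<alpha>_def \<beta>_def numeral_3_eq_3 numeral_2_eq_2)
  \<comment> \<open>A block decodes to 1 only with two ones in it, each supplied by an internal
    majority of value 1 or by a hit in the second transposition.\<close>
  have out: "2 \<le> c + \<beta> i" if "out i" for i
    using that unfolding c_def \<beta>_def out_def by (cases "M 0"; cases "M 1"; cases "M 2"; simp add: maj_def) auto
  consider (all) "maj (u 0) (u 1) (u 2)"
    | (one) i :: nat where "i < 3" "maj (u 0 \<or> 0 = i) (u 1 \<or> 1 = i) (u 2 \<or> 2 = i)" "\<not> maj (u 0) (u 1) (u 2)"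
    | (none) "\<not> u 0" "\<not> u 1" "\<not> u 2"
  proof -
    \<comment> \<open>One input with value 1 and one blamed input already form a majority, so a
      single blame accounts for all three outputs.\<close>
    have "\<exists>i :: nat. i < 3 \<and> maj (u 0 \<or> 0 = i) (u 1 \<or> 1 = i) (u 2 \<or> 2 = i)" if "u 0 \<or> u 1 \<or> u 2"
    proof (cases "u 0")
      case True
      then show ?thesis by (intro exI[of _ 1]) (simp add: maj_def)
    next
      case False
      with that show ?thesis by (intro exI[of _ 0]) (auto simp: maj_def)
    qed
    then show ?thesis using all one none by blast
  qed
  then show ?thesis
  proof cases
    case all
    then show ?thesis by (intro that[of "{}" "{}"]) auto
  next
    case one
    \<comment> \<open>At most one input is 1, so each internal majority of value 1 needs a hit of
      its own.\<close>
    have \<alpha>: "1 \<le> \<alpha> j" if "M j" for j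
      using that one(3) le[of 0] le[of 1] le[of 2] by (auto simp: M_def \<alpha>_def maj_def)
    have c: "c \<le> \<alpha> 0 + \<alpha> 1 + \<alpha> 2"
      using \<alpha>[of 0] \<alpha>[of 1] \<alpha>[of 2] by (auto simp: c_def)
    show ?thesis
    proof (cases "\<exists>k < 3. out k")
      case True
      then obtain k where k: "k < 3" "out k" by blast
      have "\<beta> k \<le> \<beta> 0 + \<beta> 1 + \<beta> 2"
        using k(1) by (auto simp: numeral_3_eq_3 less_Suc_eq numeral_2_eq_2)
      then have "2 \<le> S"
        using out[OF k(2)] c S by linarith
      then show ?thesis
        using one(1,2) by (intro that[of "{i}" "{}"]) (auto simp: S_def)
    next
      case False
      then show ?thesis by (intro that[of "{}" "{}"]) auto
    qed
  next
    case none
    have \<alpha>: "2 \<le> \<alpha> j" if "M j" for j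
      using that none le[of 0] le[of 1] le[of 2] by (auto simp: M_def \<alpha>_def maj_def)
    have c: "2 * c \<le> \<alpha> 0 + \<alpha> 1 + \<alpha> 2"
      using \<alpha>[of 0] \<alpha>[of 1] \<alpha>[of 2] by (auto simp: c_def)
    show ?thesis
    proof (cases "\<exists>k < 3. \<exists>l < 3. k \<noteq> l \<and> out k \<and> out l")
      case True
      then obtain k l where k: "k < 3" "l < 3" "k \<noteq> l" "out k" "out l" by blast
      have "\<beta> k + \<beta> l \<le> \<beta> 0 + \<beta> 1 + \<beta> 2"
        using k(1-3) by (auto simp: numeral_3_eq_3 less_Suc_eq numeral_2_eq_2)
      \<comment> \<open>Adding the inequalities for \<open>k\<close> and \<open>l\<close> counts
        \<open>c\<close> twice, and \<open>2 * c\<close> is covered by the hits in the first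
        transposition. Four hits pay for blaming two inputs, after which the ideal gadget outputs 1
        everywhere.\<close>
      then have "4 \<le> S"
        using out[OF k(4)] out[OF k(5)] c S by linarith
      then show ?thesis
        by (intro that[of "{0, 1}" "{}"]) (auto simp: S_def maj_def)
    next
      case False
      show ?thesis
      proof (cases "\<exists>k < 3. out k")
        case True
        then obtain k where k: "k < 3" "out k" by blast
        have "\<beta> k \<le> \<beta> 0 + \<beta> 1 + \<beta> 2"
          using k(1) by (auto simp: numeral_3_eq_3 less_Suc_eq numeral_2_eq_2)
        then have "2 \<le> S"
          using out[OF k(2)] c S by linarith
        then show ?thesis
          using k False by (intro that[of "{}" "{k}"]) (auto simp: S_def)
      next
        case False
        then show ?thesis by (intro that[of "{}" "{}"]) auto
      qed
    qed
  qed
qed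

text \<open>The nine bits of a group form an instance of \<open>majority_gadget_blame\<close>: the
  first transposition feeds each central majority with one bit per code block, the second gives each
  output block one bit per majority. Groups own disjoint sets of paths, so their blames can be
  combined.\<close>

lemma majority_stage:
  assumes PQ: "transposition_circuit P" "transposition_circuit Q"
    and len: "length v = 3 * m" "length u = 3 * m" and le: "v \<sqsubseteq> u"
    and N: "\<And>i. i < 3 * m \<Longrightarrow> {t..t + 11} \<times> {3 * i - 20..3 * i + 20} \<subseteq> N (t0, i)"
      "\<And>i. i < 3 * m \<Longrightarrow> {t..t + 11} \<times> {3 * i - 20..3 * i + 20} \<subseteq> N (t1, i)"
  defines "D \<equiv> side_by_side 11 (replicate m (Z1 P Q))"
  obtains I R where "I \<subseteq> {..<3 * m}" "R \<subseteq> {..<3 * m}"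
    "explained N (E \<inter> {t..t + 11} \<times> UNIV) ({t0} \<times> I \<union> {t1} \<times> R)"
    "decode_blocks (Suc 0) (3 * m) (or_run E t D (encode_blocks (Suc 0) v)) \<sqsubseteq>
      map (\<lambda>i. apply_layer (replicate m Z0) (map (\<lambda>i. u ! i \<or> i \<in> I) [0..<3 * m]) ! i \<or> i \<in> R)
        [0..<3 * m]"
proof -
  let ?DP = "side_by_side 5 (replicate m P)" and ?DQ = "side_by_side 5 (replicate m Q)"
  note P = transposition_copies[OF PQ(1), where m = m] and Q = transposition_copies[OF PQ(2), where m = m]
  obtain PathP where PathP:
    "\<And>k. k < 9 * m \<Longrightarrow> PathP k \<subseteq> {t..t + 5} \<times> {k - 5..k + 5}"
    "\<And>k l. k < 9 * m \<Longrightarrow> l < 9 * m \<Longrightarrow> k \<noteq> l \<Longrightarrow> PathP k \<inter> PathP l = {}"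
    "\<And>E s k. length s = 9 * m \<Longrightarrow> k < 9 * m \<Longrightarrow>
       or_run E t ?DP s ! k \<longleftrightarrow> fold apply_layer ?DP s ! k \<or> E \<inter> PathP k \<noteq> {}"
    by (rule swap_circuit_or_run[OF P(1), of t, unfolded length_side_by_side]) (rule that)
  obtain PathQ where PathQ:
    "\<And>k. k < 9 * m \<Longrightarrow> PathQ k \<subseteq> {t + 6..t + 6 + 5} \<times> {k - 5..k + 5}"
    "\<And>k l. k < 9 * m \<Longrightarrow> l < 9 * m \<Longrightarrow> k \<noteq> l \<Longrightarrow> PathQ k \<inter> PathQ l = {}"
    "\<And>E s k. length s = 9 * m \<Longrightarrow> k < 9 * m \<Longrightarrow>
       or_run E (t + 6) ?DQ s ! k \<longleftrightarrow> fold apply_layer ?DQ s ! k \<or> E \<inter> PathQ k \<noteq> {}"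
    by (rule swap_circuit_or_run[OF Q(1), of "t + 6", unfolded length_side_by_side]) (rule that)
  \<comment> \<open>The tag tells the two transpositions apart. Their time windows are disjoint, so
    all 18 paths of a group belong to one disjoint family and no fault is counted twice.\<close>
  define Path where "Path = (\<lambda>(c, k). if c then PathP k else PathQ k)"
  define K where "K g = (\<lambda>(c, a, b). (c, 9 * g + 3 * a + b)) ` ((UNIV :: bool set) \<times> {..<3} \<times> {..<3 :: nat})" for g :: nat
  define H where "H g = (\<Union>x \<in> K g. E \<inter> Path x)" for g
  define p where "p g a b \<longleftrightarrow> E \<inter> Path (True, 9 * g + 3 * a + b) \<noteq> {}" for g a b
  define q where "q g a b \<longleftrightarrow> E \<inter> Path (False, 9 * g + 3 * a + b) \<noteq> {}" for g a b
  have K: "snd x < 9 * m \<and> 9 * g \<le> snd x \<and> snd x \<le> 9 * g + 8" if "x \<in> K g" "g < m" for x g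
    using that by (auto simp: K_def)
  have Path_disj: "Path x \<inter> Path y = {}" if "snd x < 9 * m" "snd y < 9 * m" "x \<noteq> y" for x y
  proof (cases "fst x = fst y")
    case True
    then show ?thesis
      using that PathP(2) PathQ(2) by (cases x; cases y; simp add: Path_def)
  next
    case False
    have "PathP k \<inter> PathQ l = {}" if "k < 9 * m" "l < 9 * m" for k l
      using PathP(1)[OF that(1)] PathQ(1)[OF that(2)] by force
    then show ?thesis
      using that False by (cases x; cases y) (auto simp: Path_def)
  qed
  have Path_sub: "Path x \<subseteq> {t..t + 11} \<times> {snd x - 5..snd x + 5}" if "snd x < 9 * m" for x
  proof -
    have "PathP (snd x) \<subseteq> {t..t + 11} \<times> {snd x - 5..snd x + 5}"
      by (rule order.trans[OF PathP(1)[OF that]]) auto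
    moreover have "PathQ (snd x) \<subseteq> {t..t + 11} \<times> {snd x - 5..snd x + 5}"
      by (rule order.trans[OF PathQ(1)[OF that]]) auto
    ultimately show ?thesis by (cases x) (simp add: Path_def)
  qed
  have H: "H g \<subseteq> E \<inter> {t..t + 11} \<times> {9 * g - 5..9 * g + 13}" if "g < m" for g
  proof -
    have "Path x \<subseteq> {t..t + 11} \<times> {9 * g - 5..9 * g + 13}" if "x \<in> K g" for x
      using K[OF that \<open>g < m\<close>] by (intro order.trans[OF Path_sub]) auto
    then show ?thesis by (auto simp: H_def)
  qed
  have fin: "finite (H g)" if "g < m" for g
    using H[OF that] by (rule finite_subset) auto
  have disj: "H g \<inter> H g' = {}" if "g < m" "g' < m" "g \<noteq> g'" for g g'
  proof -
    have "Path x \<inter> Path x' = {}" if "x \<in> K g" "x' \<in> K g'" for x x'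
      using K[OF that(1)] K[OF that(2)] \<open>g < m\<close> \<open>g' < m\<close> \<open>g \<noteq> g'\<close> by (intro Path_disj) auto
    then show ?thesis unfolding H_def by blast
  qed
  have card_H: "(\<Sum>a<3. \<Sum>b<3. of_bool (p g a b) + of_bool (q g a b)) \<le> card (H g)" if g: "g < m" for g
  proof -
    have inj: "inj_on (\<lambda>(c, a, b). (c, 9 * g + 3 * a + b)) ((UNIV :: bool set) \<times> {..<3} \<times> {..<3 :: nat})"
    proof (rule inj_onI)
      fix x y :: "bool \<times> nat \<times> nat"
      obtain c a b c' a' b' where xy: "x = (c, a, b)" "y = (c', a', b')"
        by (metis prod_cases3)
      assume "x \<in> UNIV \<times> {..<3} \<times> {..<3}" "y \<in> UNIV \<times> {..<3} \<times> {..<3}"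
        "(case x of (c, a, b) \<Rightarrow> (c, 9 * g + 3 * a + b)) = (case y of (c, a, b) \<Rightarrow> (c, 9 * g + 3 * a + b))"
      then have "c = c'" "3 * a + b = 3 * a' + b'" "b < 3" "b' < 3"
        by (simp_all add: xy)
      moreover from this(2-4) have "a = a' \<and> b = b'" by presburger
      ultimately show "x = y" by (simp add: xy)
    qed
    have "(\<Sum>a<3. \<Sum>b<3. of_bool (p g a b) + of_bool (q g a b)) =
        (\<Sum>x \<in> (UNIV :: bool set) \<times> {..<3} \<times> {..<3 :: nat}. case x of (c, a, b) \<Rightarrow>
          (of_bool (E \<inter> Path (c, 9 * g + 3 * a + b) \<noteq> {}) :: nat))"
      by (simp add: UNIV_bool p_def q_def sum.distrib flip: sum.cartesian_product)
    also have "\<dots> = (\<Sum>x \<in> K g. of_bool (E \<inter> Path x \<noteq> {}))"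
      unfolding K_def by (subst sum.reindex[OF inj]) (auto intro!: sum.cong simp del: sum_of_bool_eq)
    also have "\<dots> \<le> card (H g)"
      unfolding H_def
    proof (rule card_hits_le)
      show "finite (K g)" by (simp add: K_def)
      show "finite (\<Union>x \<in> K g. E \<inter> Path x)" using fin[OF g] by (simp add: H_def)
      show "E \<inter> Path x \<inter> (E \<inter> Path y) = {}" if "x \<in> K g" "y \<in> K g" "x \<noteq> y" for x y
        using Path_disj[of x y] K[OF that(1) g] K[OF that(2) g] that(3) by blast
    qed
    finally show ?thesis .
  qed
  define M where "M g j = maj (v ! (3 * g) \<or> p g j 0) (v ! (3 * g + 1) \<or> p g j 1) (v ! (3 * g + 2) \<or> p g j 2)" for g j
  define out where "out g i = maj (M g 0 \<or> q g i 0) (M g 1 \<or> q g i 1) (M g 2 \<or> q g i 2)" for g i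
  define blame where "blame g I R \<longleftrightarrow> I \<subseteq> {..<3} \<and> R \<subseteq> {..<3} \<and>
      2 * (card I + card R) \<le> (\<Sum>a<3. \<Sum>b<3. of_bool (p g a b) + of_bool (q g a b)) \<and>
      (\<forall>i<3. out g i \<longrightarrow> maj (u ! (3 * g) \<or> 0 \<in> I) (u ! (3 * g + 1) \<or> 1 \<in> I) (u ! (3 * g + 2) \<or> 2 \<in> I) \<or> i \<in> R)"
    for g and I R :: "nat set"
  have "\<exists>I R. blame g I R"
    if g: "g < m" for g
  proof -
    have le_g: "u ! (3 * g + i)" if "i < 3" "v ! (3 * g + i)" for i
      using le g that len by (auto simp: list_all2_conv_all_nth)
    obtain I R :: "nat set" where IR: "I \<subseteq> {..<3}" "R \<subseteq> {..<3}"
      "2 * (card I + card R) \<le> (\<Sum>a<3. \<Sum>b<3. of_bool (p g a b) + of_bool (q g a b))"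
      and out: "\<And>i. i < 3 \<Longrightarrow>
        maj (maj (v ! (3 * g + 0) \<or> p g 0 0) (v ! (3 * g + 1) \<or> p g 0 1) (v ! (3 * g + 2) \<or> p g 0 2) \<or> q g i 0)
          (maj (v ! (3 * g + 0) \<or> p g 1 0) (v ! (3 * g + 1) \<or> p g 1 1) (v ! (3 * g + 2) \<or> p g 1 2) \<or> q g i 1)
          (maj (v ! (3 * g + 0) \<or> p g 2 0) (v ! (3 * g + 1) \<or> p g 2 1) (v ! (3 * g + 2) \<or> p g 2 2) \<or> q g i 2) \<Longrightarrow>
        maj (u ! (3 * g + 0) \<or> 0 \<in> I) (u ! (3 * g + 1) \<or> 1 \<in> I) (u ! (3 * g + 2) \<or> 2 \<in> I) \<or> i \<in> R"
      by (rule majority_gadget_blame[where v = "\<lambda>i. v ! (3 * g + i)" and u = "\<lambda>i. u ! (3 * g + i)"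
        and p = "p g" and q = "q g", OF le_g]) (assumption, assumption, rule that)
    have "\<forall>i<3. out g i \<longrightarrow>
        maj (u ! (3 * g) \<or> 0 \<in> I) (u ! (3 * g + 1) \<or> 1 \<in> I) (u ! (3 * g + 2) \<or> 2 \<in> I) \<or> i \<in> R"
      using out unfolding out_def M_def by simp
    then show ?thesis
      by - (rule exI[of _ I], rule exI[of _ R], unfold blame_def, intro conjI IR(1-3))
  qed
  then obtain I R where "\<And>g. g < m \<Longrightarrow> blame g (I g) (R g)"
    by metis
  then have IR: "\<And>g. g < m \<Longrightarrow> I g \<subseteq> {..<3}" "\<And>g. g < m \<Longrightarrow> R g \<subseteq> {..<3}"
    "\<And>g. g < m \<Longrightarrow> 2 * (card (I g) + card (R g)) \<le> (\<Sum>a<3. \<Sum>b<3. of_bool (p g a b) + of_bool (q g a b))"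
    "\<And>g i. g < m \<Longrightarrow> i < 3 \<Longrightarrow> out g i \<Longrightarrow>
      maj (u ! (3 * g) \<or> 0 \<in> I g) (u ! (3 * g + 1) \<or> 1 \<in> I g) (u ! (3 * g + 2) \<or> 2 \<in> I g) \<or> i \<in> R g"
    unfolding blame_def by blast+
  define A where "A g = (\<lambda>i. (t0, 3 * g + i)) ` I g \<union> (\<lambda>i. (t1, 3 * g + i)) ` R g" for g
  define I' where "I' = (\<Union>g<m. (\<lambda>i. 3 * g + i) ` I g)"
  define R' where "R' = (\<Union>g<m. (\<lambda>i. 3 * g + i) ` R g)"
  have "explained N (E \<inter> {t..t + 11} \<times> UNIV) (\<Union>g<m. A g)"
  proof (rule explained_groups[where H = H])
    fix g assume "g \<in> {..<m}"
    then have g: "g < m" by simp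
    have finIR: "finite (I g)" "finite (R g)"
      using IR(1,2)[OF g] finite_subset by blast+
    have "card (A g) \<le> card (I g) + card (R g)"
      unfolding A_def by (intro order.trans[OF card_Un_le] add_mono card_image_le finIR)
    then show "finite (A g) \<and> finite (H g) \<and> 2 * card (A g) \<le> card (H g)"
      using IR(3)[OF g] card_H[OF g] finIR fin[OF g] by (simp add: A_def)
    show "H g \<subseteq> E \<inter> {t..t + 11} \<times> UNIV"
      using H[OF g] by auto
    fix w assume "w \<in> A g"
    then obtain i where i: "i < 3" "w = (t0, 3 * g + i) \<or> w = (t1, 3 * g + i)"
      using IR(1,2)[OF g] by (auto simp: A_def)
    have "H g \<subseteq> {t..t + 11} \<times> {3 * (3 * g + i) - 20..3 * (3 * g + i) + 20}"
      using i(1) by (intro order.trans[OF H[OF g]]) auto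
    moreover have "3 * g + i < 3 * m"
      using i(1) g by simp
    ultimately show "H g \<subseteq> N w"
      using i(2) N[of "3 * g + i"] by blast
  next
    fix g g' assume "g \<in> {..<m}" "g' \<in> {..<m}" "g \<noteq> g'"
    then show "H g \<inter> H g' = {}" by (intro disj) auto
  qed
  moreover have "(\<Union>g<m. A g) = {t0} \<times> I' \<union> {t1} \<times> R'"
    by (auto simp: A_def I'_def R'_def)
  ultimately have "explained N (E \<inter> {t..t + 11} \<times> UNIV) ({t0} \<times> I' \<union> {t1} \<times> R')"
    by simp
  moreover have "I' \<subseteq> {..<3 * m}" "R' \<subseteq> {..<3 * m}"
    using IR(1,2) by (force simp: I'_def R'_def)+
  moreover have "apply_layer (replicate m Z0) (map (\<lambda>i. u ! i \<or> i \<in> I') [0..<3 * m]) ! k \<or> k \<in> R'"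
    if k: "k < 3 * m" and dec: "decode_blocks (Suc 0) (3 * m) (or_run E t D (encode_blocks (Suc 0) v)) ! k" for k
  proof -
    obtain g i where gi: "k = 3 * g + i" "g < m" "i < 3"
      using that[of "k div 3" "k mod 3"] k by (simp add: less_mult_imp_div_less mult.commute)
    let ?s1 = "or_run E t ?DP (encode_blocks (Suc 0) v)"
    let ?y = "decode_blocks (Suc 0) (3 * m) ?s1"
    let ?s3 = "or_run E (t + 6) ?DQ (encode_blocks (Suc 0) ?y)"
    have w: "has_width (9 * m) ?DP" "has_width (9 * m) ?DQ"
      using P(1) Q(1) by (simp_all add: swap_circuit_def)
    have l1: "length ?s1 = 9 * m"
      using length_or_run[of "encode_blocks (Suc 0) v" ?DP] w(1) len by simp
    have l3: "length ?s3 = 9 * m"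
      using length_or_run[of "encode_blocks (Suc 0) ?y" ?DQ] w(2) by simp
    have idx: "9 * g + 3 * a + b < 9 * m" if "a < 3" "b < 3" for a b :: nat
      using that gi(2) by linarith
    have D: "or_run E t D (encode_blocks (Suc 0) v) = ?s3"
      using transposition_swap_circuit(1)[OF PQ(1)] transposition_swap_circuit(1)[OF PQ(2)] l1
      by (simp add: D_def level1_maj_layer or_run_append apply_EC_layer)
    have s1: "?s1 ! (9 * g + 3 * a + b) \<longleftrightarrow> v ! (3 * g + b) \<or> p g a b" if "a < 3" "b < 3" for a b
      using that gi(2) idx[OF that] len by (simp add: PathP(3) P(2) p_def Path_def)
    have y: "?y ! (3 * g + a) = M g a" if a: "a < 3" for a
    proof -
      have "3 * g + a < 3 * m" using gi(2) a by linarith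
      then show ?thesis
        using l1 s1[OF a, of 0] s1[OF a, of 1] s1[OF a, of 2]
        by (simp add: decode_blocks_1_nth M_def add_mult_distrib2)
    qed
    have s3: "?s3 ! (9 * g + 3 * a + b) \<longleftrightarrow> M g b \<or> q g a b" if "a < 3" "b < 3" for a b
      using that gi(2) idx[OF that] by (simp add: PathQ(3) Q(2) q_def Path_def y)
    have out: "out g i"
      using dec k l3 s3[OF gi(3), of 0] s3[OF gi(3), of 1] s3[OF gi(3), of 2]
      unfolding D by (simp add: decode_blocks_1_nth out_def add_mult_distrib2 gi(1))
    have I: "maj (u ! (3 * g) \<or> 0 \<in> I g) (u ! (3 * g + 1) \<or> 1 \<in> I g) (u ! (3 * g + 2) \<or> 2 \<in> I g) \<Longrightarrow>
       apply_layer (replicate m Z0) (map (\<lambda>i. u ! i \<or> i \<in> I') [0..<3 * m]) ! k"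
    proof -
      assume maj: "maj (u ! (3 * g) \<or> 0 \<in> I g) (u ! (3 * g + 1) \<or> 1 \<in> I g) (u ! (3 * g + 2) \<or> 2 \<in> I g)"
      let ?x = "map (\<lambda>i. u ! i \<or> i \<in> I') [0..<3 * m]"
      have "apply_layer (replicate m Z0) ?x = encode_blocks (Suc 0) (decode_blocks (Suc 0) m ?x)"
        using apply_EC_layer[of ?x m] by (simp add: EC_layer_def)
      moreover have "3 * g + j \<in> I'" if "j \<in> I g" for j
        using that gi(2) by (auto simp: I'_def)
      from this[of 0] this[of 1] this[of 2] have "decode_blocks (Suc 0) m ?x ! g"
        using maj gi(2) by (auto simp: decode_blocks_1_nth maj_def)
      ultimately show ?thesis
        using gi by (simp add: encode_blocks_1_nth)
    qed
    show ?thesis using IR(4)[OF gi(2,3) out] I gi by (auto simp: R'_def)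
  qed
  ultimately show ?thesis
    by (intro that[of I' R']) (auto simp: list_all2_conv_all_nth len)
qed


section \<open>Reduction by one level\<close>

text \<open>Homogeneity makes the level-1 gadgets of a layer equally long, so no padding occurs;
  nonemptiness makes \<open>width C\<close> equal to \<open>w\<close>.\<close>

definition well_formed :: "nat \<Rightarrow> circuit \<Rightarrow> bool" where
  "well_formed w C \<longleftrightarrow> C \<noteq> [] \<and> (\<forall>L \<in> set C. homogeneous L \<and> layer_width L = w)"

lemma layer_width_maj: "set L \<subseteq> {Z0} \<Longrightarrow> layer_width L = 3 * length L"
  by (induction L) auto

lemma juxtapose_level1_cases:
  assumes PQ: "transposition_circuit P" "transposition_circuit Q"
    and L: "homogeneous L" "L \<noteq> []"
  obtains (swap) "set L \<subseteq> {X0, Y0}" "juxtapose (map (level1 P Q) L) = side_by_side 5 (map (level1 P Q) L)"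
    | (maj) m where "L = replicate m Z0" "layer_width L = 3 * m"
      "juxtapose (map (level1 P Q) L) = side_by_side 11 (replicate m (Z1 P Q))"
proof (cases "set L \<subseteq> {X0, Y0}")
  case True
  have "length (level1 P Q g) = 5" if "g \<in> set L" for g
    using that True by (intro level1_swap_gadget(1)) auto
  then have "juxtapose (map (level1 P Q) L) = side_by_side 5 (map (level1 P Q) L)"
    using L(2) by (intro juxtapose_eq_side_by_side) auto
  with True show ?thesis by (rule swap)
next
  case False
  then have Z: "set L \<subseteq> {Z0}"
    using L(1) by (auto simp: homogeneous_def)
  have L': "L = replicate (length L) Z0"
    using Z by (intro replicate_eqI) auto
  have "length (Z1 P Q) = 11"
    using PQ by (simp add: Z1_def transposition_swap_circuit)
  then have "juxtapose (map (level1 P Q) L) = side_by_side 11 (map (level1 P Q) L)"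
    using L(2) Z by (intro juxtapose_eq_side_by_side) auto
  moreover have "map (level1 P Q) L = replicate (length L) (Z1 P Q)"
    by (subst L') simp
  ultimately show ?thesis
    using maj[OF L'] layer_width_maj[OF Z] by simp
qed

lemma well_formed_FT:
  assumes PQ: "transposition_circuit P" "transposition_circuit Q"
    and C: "well_formed w C" "0 < w"
  shows "well_formed (3 * w) (FT P Q C)"
proof -
  have w: "width C = w"
    using C(1) by (auto simp: well_formed_def width_def)
  have EC: "homogeneous (EC_layer w)" "layer_width (EC_layer w) = 3 * w"
    by (auto simp: homogeneous_def EC_layer_def)
  have "homogeneous K \<and> layer_width K = 3 * w"
    if "L \<in> set C" "K \<in> set (juxtapose (map (level1 P Q) L))" for L K
  proof -
    have L: "homogeneous L" "layer_width L = w" "L \<noteq> []"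
      using C that(1) by (auto simp: well_formed_def)
    have "has_width (3 * w) (juxtapose (map (level1 P Q) L))"
      using PQ L(1,3)
    proof (cases rule: juxtapose_level1_cases)
      case swap
      then show ?thesis
        using level1_swap_layer(1)[OF swap(1)] L(2) by (simp add: swap_circuit_def)
    next
      case (maj m)
      then have w': "3 * w = 9 * m"
        using L(2) by simp
      from maj show ?thesis
        using transposition_copies(1)[OF PQ(1), of m] transposition_copies(1)[OF PQ(2), of m] PQ w'
        by (simp add: level1_maj_layer transposition_swap_circuit swap_circuit_def EC_layer_def)
    qed
    moreover have "homogeneous K"
      by (rule set_juxtapose_level1[OF _ _ L(1) that(2)])
         (use PQ in \<open>auto simp: transposition_circuit_def\<close>)
    ultimately show ?thesis
      using that(2) by (simp add: has_width_def)
  qed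
  then show ?thesis
    using EC by (auto simp: well_formed_def FT_def w)
qed

text \<open>\<open>v\<close> holds the decoded bits of the simulation, \<open>u\<close> the bits of
  the simulated OR process. A swap layer blames output wires only; a majority layer may also blame
  its inputs, hence the two times \<open>t0\<close> and \<open>t1\<close>.\<close>

lemma layer_stage:
  assumes PQ: "transposition_circuit P" "transposition_circuit Q"
    and L: "homogeneous L" "L \<noteq> []" "layer_width L = w"
    and len: "length v = w" "length u = w" and le: "v \<sqsubseteq> u"
  defines "D \<equiv> juxtapose (map (level1 P Q) L)"
  assumes N: "\<And>i. i < w \<Longrightarrow> {t..t + length D} \<times> {3 * i - 20..3 * i + 20} \<subseteq> N (t0, i)"
      "\<And>i. i < w \<Longrightarrow> {t..t + length D} \<times> {3 * i - 20..3 * i + 20} \<subseteq> N (t1, i)"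
  obtains I R where "I \<subseteq> {..<w}" "R \<subseteq> {..<w}"
    "explained N (E \<inter> {t..t + length D} \<times> UNIV) ({t0} \<times> I \<union> {t1} \<times> R)"
    "decode_blocks (Suc 0) w (or_run E t D (encode_blocks (Suc 0) v)) \<sqsubseteq>
      map (\<lambda>i. apply_layer L (map (\<lambda>i. u ! i \<or> i \<in> I) [0..<w]) ! i \<or> i \<in> R) [0..<w]"
  using PQ L(1,2)
proof (cases rule: juxtapose_level1_cases)
  case swap
  have D: "D = side_by_side 5 (map (level1 P Q) L)" "length D = 5"
    using swap by (simp_all add: D_def)
  have lens: "length (apply_layer L v) = w" "length (apply_layer L u) = w"
    using len L(3) by (simp_all add: length_apply_layer)
  have sw: "swap_circuit (3 * w) D" "length D \<le> 5"
    using level1_swap_layer(1)[OF swap(1), of P Q] D L(3) by simp_all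
  have fold: "fold apply_layer D (encode_blocks (Suc 0) v) = encode_blocks (Suc 0) (apply_layer L v)"
    using level1_swap_layer(2)[OF swap(1)] D(1) L(3) len(1) by simp
  obtain R where R: "R \<subseteq> {..<w}" "explained N (E \<inter> {t..t + length D} \<times> UNIV) ({t1} \<times> R)"
    "decode_blocks (Suc 0) w (or_run E t D (encode_blocks (Suc 0) v)) \<sqsubseteq>
      map (\<lambda>i. apply_layer L v ! i \<or> i \<in> R) [0..<w]"
    by (rule swap_stage[where N = N and t' = t1 and t = t and E = E, OF sw len(1) lens(1) fold N(2)])
      (assumption, rule that)
  have "apply_layer L v \<sqsubseteq> apply_layer L u"
    using le len L(3) by (intro apply_layer_mono) auto
  then have "map (\<lambda>i. apply_layer L v ! i \<or> i \<in> R) [0..<w] \<sqsubseteq>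
      map (\<lambda>i. apply_layer L (map (\<lambda>i. u ! i \<or> i \<in> {}) [0..<w]) ! i \<or> i \<in> R) [0..<w]"
    using lens len map_nth[of u] by (auto simp: list_all2_conv_all_nth)
  with R(3) have "decode_blocks (Suc 0) w (or_run E t D (encode_blocks (Suc 0) v)) \<sqsubseteq>
      map (\<lambda>i. apply_layer L (map (\<lambda>i. u ! i \<or> i \<in> {}) [0..<w]) ! i \<or> i \<in> R) [0..<w]"
    by (auto simp: list_all2_conv_all_nth)
  then show ?thesis
    using R(1,2) by (intro that[of "{}" R]) auto
next
  case (maj m)
  have D: "D = side_by_side 11 (replicate m (Z1 P Q))" "length D = 11" and w: "w = 3 * m"
    using maj L(3) by (simp_all add: D_def)
  note N' = N[unfolded D(2) w]
  have len': "length v = 3 * m" "length u = 3 * m"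
    using len w by simp_all
  obtain I R where "I \<subseteq> {..<3 * m}" "R \<subseteq> {..<3 * m}"
    "explained N (E \<inter> {t..t + 11} \<times> UNIV) ({t0} \<times> I \<union> {t1} \<times> R)"
    "decode_blocks (Suc 0) (3 * m) (or_run E t D (encode_blocks (Suc 0) v)) \<sqsubseteq>
      map (\<lambda>i. apply_layer (replicate m Z0) (map (\<lambda>i. u ! i \<or> i \<in> I) [0..<3 * m]) ! i \<or> i \<in> R)
        [0..<3 * m]"
    by (rule majority_stage[where N = N and t = t and ?t0.0 = t0 and ?t1.0 = t1 and E = E,
          OF PQ len' le N', folded D(1)])
      (assumption, assumption, erule (3) that)
  then show ?thesis
    using that[of I R] by (simp add: D(2) w maj(1))
qed

text \<open>This is \<open>FT\<close> after its first error correction. The width is a parameter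
  because an induction over the layers ends with the empty circuit, whose \<open>width\<close> is
  0.\<close>

definition FT_body :: "circuit \<Rightarrow> circuit \<Rightarrow> nat \<Rightarrow> circuit \<Rightarrow> circuit" where
  "FT_body P Q w C = concat (map (\<lambda>L. juxtapose (map (level1 P Q) L) @ [EC_layer w]) C)"

text \<open>The invariant \<open>v \<sqsubseteq> u\<close> passes from one error correction to the
  next. \<open>st t\<close> is the time at which the simulation of layer \<open>t\<close> starts;
  the window of a layer ends at the inputs of the following error correction, so successive windows
  are disjoint and the explanations add up.\<close>

lemma body_reduction:
  assumes PQ: "transposition_circuit P" "transposition_circuit Q" and "0 < w"
  defines "N st \<equiv> \<lambda>(t, i). {st t - 12..st t + 12} \<times> {3 * i - 20..3 * i + (20 :: nat)}"
  assumes "\<forall>L \<in> set C. homogeneous L \<and> layer_width L = w"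
    and "length v = w" "length u = w" "v \<sqsubseteq> u"
    and "\<And>j. j < length C \<Longrightarrow>
      st (t + Suc j) = st (t + j) + Suc (length (juxtapose (map (level1 P Q) (C ! j))))"
  shows "\<exists>E' \<subseteq> {t..t + length C} \<times> {..<w}. explained (N st) (E \<inter> {st t..} \<times> UNIV) E' \<and>
    decode_blocks (Suc 0) w (or_run E (st t) (FT_body P Q w C) (encode_blocks (Suc 0) v)) \<sqsubseteq>
      or_run E' t C u"
  using assms(5-)
proof (induction C arbitrary: t v u)
  case Nil
  \<comment> \<open>Only the circuit outputs remain. They are treated as a swap circuit without
    layers, whose window is the single time \<open>st t\<close>.\<close>
  obtain R where R: "R \<subseteq> {..<w}"
    "explained (N st) (E \<inter> {st t..st t + length ([] :: circuit)} \<times> UNIV) ({t} \<times> R)"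
    "decode_blocks (Suc 0) w (or_run E (st t) [] (encode_blocks (Suc 0) v)) \<sqsubseteq>
      map (\<lambda>i. v ! i \<or> i \<in> R) [0..<w]"
    by (rule swap_stage[where D = "[]" and y = v and w = w and t = "st t" and t' = t and N = "N st"
        and v = v and E = E])
       (use Nil in \<open>auto simp: swap_circuit_def N_def\<close>)
  have "map (\<lambda>i. v ! i \<or> i \<in> R) [0..<w] \<sqsubseteq> or_run ({t} \<times> R) t [] u"
    using Nil by (auto simp: list_all2_conv_all_nth)
  with R(3) have "decode_blocks (Suc 0) w (or_run E (st t) [] (encode_blocks (Suc 0) v)) \<sqsubseteq>
      or_run ({t} \<times> R) t [] u"
    by (auto simp: list_all2_conv_all_nth)
  moreover have "explained (N st) (E \<inter> {st t..} \<times> UNIV) ({t} \<times> R)"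
    using R(2) by (rule explained_mono) auto
  ultimately show ?case
    using R(1) by (intro exI[of _ "{t} \<times> R"]) (auto simp: FT_body_def)
next
  case (Cons L C)
  define D where "D = juxtapose (map (level1 P Q) L)"
  have L: "homogeneous L" "layer_width L = w" "L \<noteq> []"
    using Cons.prems(1) \<open>0 < w\<close> by auto
  have wC: "has_width w C"
    using Cons.prems(1) by (auto simp: has_width_def)
  have st: "st (Suc t) = st t + Suc (length D)"
    using Cons.prems(5)[of 0] by (simp add: D_def)
  have len_D: "length D \<le> 11" and wD: "has_width (3 * w) D"
  proof -
    show "length D \<le> 11"
      using PQ L(1,3) by (cases rule: juxtapose_level1_cases) (simp_all add: D_def)
    \<comment> \<open>The simulation of the one-layer circuit \<open>[L]\<close> contains all layers
      of \<open>D\<close>, so their width can be read off from it.\<close>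
    have "well_formed (3 * w) (FT P Q [L])"
      using PQ L(1,2) \<open>0 < w\<close> by (intro well_formed_FT) (simp_all add: well_formed_def)
    then show "has_width (3 * w) D"
      by (auto simp: well_formed_def FT_def D_def has_width_def)
  qed
  obtain I R where IR: "I \<subseteq> {..<w}" "R \<subseteq> {..<w}"
    "explained (N st) (E \<inter> {st t..st t + length D} \<times> UNIV) ({t} \<times> I \<union> {Suc t} \<times> R)"
    "decode_blocks (Suc 0) w (or_run E (st t) D (encode_blocks (Suc 0) v)) \<sqsubseteq>
      map (\<lambda>i. apply_layer L (map (\<lambda>i. u ! i \<or> i \<in> I) [0..<w]) ! i \<or> i \<in> R) [0..<w]"
  proof (rule layer_stage[OF PQ L(1,3,2) Cons.prems(2-4), where t = "st t" and E = E and N = "N st"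
        and ?t0.0 = t and ?t1.0 = "Suc t"])
    fix i assume "i < w"
    show "{st t..st t + length (juxtapose (map (level1 P Q) L))} \<times> {3 * i - 20..3 * i + 20} \<subseteq> N st (t, i)"
      using len_D by (auto simp: N_def D_def)
    show "{st t..st t + length (juxtapose (map (level1 P Q) L))} \<times> {3 * i - 20..3 * i + 20} \<subseteq> N st (Suc t, i)"
      using len_D st by (auto simp: N_def D_def)
  qed (use that in \<open>auto simp: D_def\<close>)
  define y where "y = apply_layer L (map (\<lambda>i. u ! i \<or> i \<in> I) [0..<w])"
  define u' where "u' = map (\<lambda>i. y ! i \<or> i \<in> R) [0..<w]"
  define v' where "v' = decode_blocks (Suc 0) w (or_run E (st t) D (encode_blocks (Suc 0) v))"
  have len_y: "length y = w"
    using L(2) by (simp add: y_def length_apply_layer)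
  have "v' \<sqsubseteq> u'"
    using IR(4) by (simp add: v'_def u'_def y_def)
  moreover have "st (Suc t + Suc j) = st (Suc t + j) + Suc (length (juxtapose (map (level1 P Q) (C ! j))))"
    if "j < length C" for j
    using Cons.prems(5)[of "Suc j"] that by simp
  ultimately obtain E'' where E'': "E'' \<subseteq> {Suc t..Suc t + length C} \<times> {..<w}"
    "explained (N st) (E \<inter> {st (Suc t)..} \<times> UNIV) E''"
    "decode_blocks (Suc 0) w (or_run E (st (Suc t)) (FT_body P Q w C) (encode_blocks (Suc 0) v')) \<sqsubseteq>
      or_run E'' (Suc t) C u'"
    using Cons.IH[of v' u' "Suc t"] Cons.prems(1) by (auto simp: v'_def u'_def)
  let ?E' = "{t} \<times> I \<union> {Suc t} \<times> R \<union> E''"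
  have "?E' \<subseteq> {t..t + length (L # C)} \<times> {..<w}"
    using IR(1,2) E''(1) by auto
  moreover have "explained (N st) (E \<inter> {st t..} \<times> UNIV) ?E'"
  proof (rule explained_mono[OF explained_Un[OF IR(3) E''(2)]])
    show "E \<inter> {st t..st t + length D} \<times> UNIV \<inter> (E \<inter> {st (Suc t)..} \<times> UNIV) = {}"
      using st by auto
    show "E \<inter> {st t..st t + length D} \<times> UNIV \<union> E \<inter> {st (Suc t)..} \<times> UNIV \<subseteq> E \<inter> {st t..} \<times> UNIV"
      using st by auto
  qed
  moreover have "decode_blocks (Suc 0) w
      (or_run E (st t) (FT_body P Q w (L # C)) (encode_blocks (Suc 0) v)) \<sqsubseteq> or_run ?E' t (L # C) u"
  proof -
    have "length (or_run E (st t) D (encode_blocks (Suc 0) v)) = 3 * w"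
      using Cons.prems(2) wD length_or_run[of "encode_blocks (Suc 0) v" D] by simp
    then have "or_run E (st t) (FT_body P Q w (L # C)) (encode_blocks (Suc 0) v) =
        or_run E (st (Suc t)) (FT_body P Q w C) (encode_blocks (Suc 0) v')"
      by (simp add: FT_body_def or_run_append st v'_def apply_EC_layer flip: D_def)
    \<comment> \<open>At time \<open>t\<close> only \<open>I\<close> acts: \<open>R\<close> and
      \<open>E''\<close> live at later times.\<close>
    moreover have "or_at ?E' t u = map (\<lambda>i. u ! i \<or> i \<in> I) [0..<w]"
      using E''(1) Cons.prems(3) by (auto simp: or_at_def)
    then have "or_run ?E' t (L # C) u = or_run ?E' (Suc t) C y"
      by (simp add: y_def)
    \<comment> \<open>The errors \<open>R\<close> are part of the state \<open>u'\<close> on the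
      left and faulty wires at time \<open>Suc t\<close> on the right.\<close>
    moreover have "or_run E'' (Suc t) C u' \<sqsubseteq> or_run ?E' (Suc t) C y"
      using wC len_y by (intro or_run_mono) (auto simp: u'_def list_all2_conv_all_nth)
    ultimately show ?thesis
      using list_all2_trans[OF _ E''(3)] by (simp add: list_all2_conv_all_nth) (use E''(3) in \<open>auto simp: list_all2_conv_all_nth\<close>)
  qed
  ultimately show ?case
    by (intro exI[of _ ?E']) simp
qed

text \<open>The neighbourhoods \<open>N\<close> are chosen before \<open>E\<close> and
  \<open>x\<close>: the later union bound ranges over possible positions of faults, which must not
  depend on the faults.\<close>

lemma FT_reduction:
  assumes PQ: "transposition_circuit P" "transposition_circuit Q"
    and C: "well_formed w C" "0 < w"
  obtains N where "\<And>x. finite (N x) \<and> card (N x) \<le> 1025"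
    "\<And>E x. length x = w \<Longrightarrow> \<exists>E' \<subseteq> wires C. explained N E E' \<and>
      decode_blocks (Suc 0) w (or_run E 0 (FT P Q C) (encode_blocks (Suc 0) x)) \<sqsubseteq> or_run E' 0 C x"
proof -
  \<comment> \<open>The outer \<open>Suc\<close> counts the initial error correction, the inner one
    the error correction after each layer.\<close>
  define st where "st j = Suc (\<Sum>k<j. Suc (length (juxtapose (map (level1 P Q) (C ! k)))))" for j
  \<comment> \<open>The longest level-1 gadget has 11 layers, so a fault lies at most 11 steps after
    the start time of a blamed input and at most 12 before that of a blamed output. The margin 20 is
    generous: a group of nine bits widened by five on either side stays within 13 of the blocks it
    affects. Subtraction truncated at 0 only shrinks the box of \<open>25 * 41 = 1025\<close>
    wires.\<close>
  define N where "N = (\<lambda>(t, i). {st t - 12..st t + 12} \<times> {3 * i - 20..3 * i + (20 :: nat)})"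
  have w: "width C = w" and wC: "has_width w C"
    using C(1) by (auto simp: well_formed_def width_def has_width_def)
  have "card (N (t, i)) \<le> 25 * 41" for t i
    unfolding N_def by (simp only: card_cartesian_product prod.case, intro mult_le_mono) simp_all
  then have "finite (N x) \<and> card (N x) \<le> 1025" for x
    by (cases x) (simp add: N_def)
  moreover have "\<exists>E' \<subseteq> wires C. explained N E E' \<and>
      decode_blocks (Suc 0) w (or_run E 0 (FT P Q C) (encode_blocks (Suc 0) x)) \<sqsubseteq> or_run E' 0 C x"
    if x: "length x = w" for E x
  proof -
    \<comment> \<open>The circuit inputs precede the first error correction and form a window of
      their own at time 0, again a swap circuit without layers.\<close>
    obtain R where R: "R \<subseteq> {..<w}"
      "explained N (E \<inter> {0..0 + length ([] :: circuit)} \<times> UNIV) ({0} \<times> R)"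
      "decode_blocks (Suc 0) w (or_run E 0 [] (encode_blocks (Suc 0) x)) \<sqsubseteq>
        map (\<lambda>i. x ! i \<or> i \<in> R) [0..<w]"
      by (rule swap_stage[where D = "[]" and y = x and w = w and t = 0 and t' = 0 and N = N
          and v = x and E = E])
         (use x in \<open>auto simp: swap_circuit_def N_def st_def\<close>)
    define v where "v = decode_blocks (Suc 0) w (or_run E 0 [] (encode_blocks (Suc 0) x))"
    define u where "u = map (\<lambda>i. x ! i \<or> i \<in> R) [0..<w]"
    have "\<exists>E' \<subseteq> {0..0 + length C} \<times> {..<w}. explained N (E \<inter> {st 0..} \<times> UNIV) E' \<and>
      decode_blocks (Suc 0) w (or_run E (st 0) (FT_body P Q w C) (encode_blocks (Suc 0) v)) \<sqsubseteq>
        or_run E' 0 C u"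
      unfolding N_def
      by (rule body_reduction[OF PQ C(2)])
         (use C(1) R(3) in \<open>auto simp: well_formed_def st_def v_def u_def\<close>)
    then obtain E'' where E'': "E'' \<subseteq> {0..length C} \<times> {..<w}"
      "explained N (E \<inter> {st 0..} \<times> UNIV) E''"
      "decode_blocks (Suc 0) w (or_run E (st 0) (FT_body P Q w C) (encode_blocks (Suc 0) v)) \<sqsubseteq>
        or_run E'' 0 C u"
      by auto
    let ?E' = "{0} \<times> R \<union> E''"
    have "?E' \<subseteq> wires C"
      using R(1) E''(1) by (auto simp: wires_def w)
    moreover have "explained N E ?E'"
      by (rule explained_mono[OF explained_Un[OF R(2) E''(2)]]) (auto simp: st_def)
    moreover have "or_run E 0 (FT P Q C) (encode_blocks (Suc 0) x) =
        or_run E (st 0) (FT_body P Q w C) (encode_blocks (Suc 0) v)"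
      using x by (simp add: FT_def FT_body_def w st_def v_def apply_EC_layer)
    moreover have "or_run E'' 0 C u \<sqsubseteq> or_run ?E' 0 C x"
      using wC x by (intro or_run_mono) (auto simp: u_def list_all2_conv_all_nth)
    ultimately show ?thesis
      using E''(3) by (intro exI[of _ ?E']) (auto simp: list_all2_conv_all_nth)
  qed
  ultimately show ?thesis by (rule that)
qed


section \<open>Probability bounds\<close>

lemma finite_wires [simp]: "finite (wires C)"
  by (simp add: wires_def)

lemma bounded_wire_errors_mono:
  assumes "bounded_wire_errors q C \<E>" "0 \<le> q" "q \<le> q'"
  shows "bounded_wire_errors q' C \<E>"
  using assms unfolding bounded_wire_errors_def by (meson order.trans power_mono)

text \<open>Union bound over the positions of the charged faults: there are at most
  \<open>K ^ (2 * card W)\<close> choices, and each requires \<open>2 * card W\<close> distinct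
  wires to be faulty. Injectivity of the charging is what yields the full exponent.\<close>

lemma bounded_wire_errors_explained:
  fixes p :: real and K :: nat
  assumes \<E>: "bounded_wire_errors p C \<E>" and "0 \<le> p"
    and N: "\<And>x. finite (N x) \<and> card (N x) \<le> K"
    and f: "\<And>E. f E \<subseteq> wires C'" "\<And>E. explained N E (f E)"
  shows "bounded_wire_errors ((K * p)\<^sup>2) C' (map_pmf f \<E>)"
  unfolding bounded_wire_errors_def
proof (intro conjI ballI allI impI)
  show "E \<subseteq> wires C'" if "E \<in> set_pmf (map_pmf f \<E>)" for E
    using that f(1) by auto
next
  fix W assume "W \<subseteq> wires C'"
  then have "finite W" by (rule finite_subset) simp
  define X where "X = W \<times> (UNIV :: bool set)"
  \<comment> \<open>\<open>G\<close> collects the possible positions. Requiring the image to lie in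
    \<open>wires C\<close> makes the bound on \<open>\<E>\<close> applicable to it.\<close>
  define G where "G = {g \<in> PiE X (\<lambda>(w, b). N w). inj_on g X \<and> g ` X \<subseteq> wires C}"
  have X: "finite X" "card X = 2 * card W"
    using \<open>finite W\<close> by (simp_all add: X_def card_cartesian_product)
  have fin: "finite (PiE X (\<lambda>(w, b). N w))"
    using X(1) N by (intro finite_PiE) auto
  have G: "finite G" "card G \<le> K ^ card X"
  proof -
    show "finite G"
      using fin by (simp add: G_def)
    have "card G \<le> card (PiE X (\<lambda>(w, b). N w))"
      using fin by (intro card_mono) (auto simp: G_def)
    also have "\<dots> = (\<Prod>x \<in> X. card (N (fst x)))"
      using X(1) by (simp add: card_PiE split_def)
    also have "\<dots> \<le> (\<Prod>x \<in> X. K)"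
      using N by (intro prod_mono) auto
    finally show "card G \<le> K ^ card X" by simp
  qed
  have "measure_pmf.prob (map_pmf f \<E>) {E'. W \<subseteq> E'} = measure_pmf.prob \<E> {E. W \<subseteq> f E}"
    by (simp add: vimage_def)
  also have "\<dots> \<le> measure_pmf.prob \<E> (\<Union>g \<in> G. {E. g ` X \<subseteq> E})"
  proof (rule measure_pmf.finite_measure_mono_AE)
    have "\<exists>g \<in> G. g ` X \<subseteq> E" if "E \<in> set_pmf \<E>" "W \<subseteq> f E" for E
    proof -
      obtain h :: "wire \<times> bool \<Rightarrow> wire" where h: "inj_on h (f E \<times> UNIV)"
        "\<forall>w \<in> f E. \<forall>b. h (w, b) \<in> E \<inter> N w"
        using f(2)[of E] unfolding explained_def by blast
      have sub: "h ` X \<subseteq> E"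
        using h(2) that(2) by (auto simp: X_def)
      have "E \<subseteq> wires C"
        using \<E> that(1) by (simp add: bounded_wire_errors_def)
      moreover have "inj_on h X"
        using h(1) that(2) by (auto simp: X_def intro: inj_on_subset)
      moreover have "restrict h X \<in> PiE X (\<lambda>(w, b). N w)"
        using h(2) that(2) by (auto simp: X_def)
      ultimately have "restrict h X \<in> G"
        using sub by (auto simp: G_def)
      then show ?thesis
        using sub by (intro bexI[of _ "restrict h X"]) auto
    qed
    then show "AE E in \<E>. E \<in> {E. W \<subseteq> f E} \<longrightarrow> E \<in> (\<Union>g \<in> G. {E. g ` X \<subseteq> E})"
      by (auto simp: AE_measure_pmf_iff)
  qed simp
  also have "\<dots> \<le> (\<Sum>g \<in> G. measure_pmf.prob \<E> {E. g ` X \<subseteq> E})"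
    using G(1) by (intro measure_pmf.finite_measure_subadditive_finite) auto
  also have "\<dots> \<le> (\<Sum>g \<in> G. p ^ card X)"
  proof (rule sum_mono)
    fix g assume "g \<in> G"
    then show "measure_pmf.prob \<E> {E. g ` X \<subseteq> E} \<le> p ^ card X"
      using \<E> by (auto simp: G_def bounded_wire_errors_def card_image)
  qed
  also have "\<dots> \<le> real (K ^ card X) * p ^ card X"
    using G(2) \<open>0 \<le> p\<close> by (simp add: mult_right_mono flip: of_nat_power)
  also have "\<dots> = ((K * p)\<^sup>2) ^ card W"
    by (simp add: X(2) power_mult_distrib power_mult)
  finally show "measure_pmf.prob (map_pmf f \<E>) {E'. W \<subseteq> E'} \<le> ((K * p)\<^sup>2) ^ card W" .
qed

lemma bounded_wire_errors_nonempty: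
  fixes q :: real
  assumes "bounded_wire_errors q C \<E>"
  shows "measure_pmf.prob \<E> {E. E \<noteq> {}} \<le> card (wires C) * q"
proof -
  have "measure_pmf.prob \<E> {E. E \<noteq> {}} \<le> measure_pmf.prob \<E> (\<Union>w \<in> wires C. {E. {w} \<subseteq> E})"
    using assms by (intro measure_pmf.finite_measure_mono_AE)
      (auto simp: AE_measure_pmf_iff bounded_wire_errors_def)
  also have "\<dots> \<le> (\<Sum>w \<in> wires C. measure_pmf.prob \<E> {E. {w} \<subseteq> E})"
    by (intro measure_pmf.finite_measure_subadditive_finite) auto
  also have "\<dots> \<le> (\<Sum>w \<in> wires C. q ^ card {w})"
    using assms unfolding bounded_wire_errors_def by (intro sum_mono) blast
  finally show ?thesis by simp
qed


section \<open>The idle circuit\<close>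

lemma well_formed_FT_pow_idle:
  assumes "transposition_circuit P" "transposition_circuit Q" "1 \<le> T"
  shows "well_formed (3 ^ n) (FT_pow P Q n (idle_circuit T))"
proof (induction n)
  case 0
  show ?case
    using assms(3) by (simp add: FT_pow_def well_formed_def idle_circuit_def homogeneous_def)
next
  case (Suc n)
  then show ?case
    using well_formed_FT[OF assms(1,2) Suc] by (simp add: FT_pow_def)
qed

lemma encode_blocks_replicate: "encode_blocks (Suc 0) (replicate k b) = replicate (3 * k) b"
  by (induction k) (simp_all add: numeral_3_eq_3)

lemma or_run_no_noise_idle: "or_run {} t (idle_circuit T) [b] = [b]"
  by (induction T arbitrary: t) (simp_all add: idle_circuit_def or_at_def)

lemma noisy_run_no_noise_idle: "noisy_run {} t (idle_circuit T) [b] = [b]"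
  by (induction T arbitrary: t) (simp_all add: idle_circuit_def flip_at_def)

lemma noisy_run_single_error_idle:
  "noisy_run {(r, 0)} t (idle_circuit T) [b] = [b \<noteq> (t \<le> r \<and> r \<le> t + T)]"
  by (induction T arbitrary: t b) (auto simp: idle_circuit_def flip_at_def)

text \<open>For \<open>b = True\<close> the same flips \<open>F\<close> are applied to the negated
  input: by self-duality they produce the negated output, hence an error for the input 0.\<close>

lemma noisy_decode_error:
  assumes C: "has_width (3 ^ n) C" and "F \<subseteq> E"
    and err: "decode n (noisy_run F 0 C (replicate (3 ^ n) b)) \<noteq> b"
  shows "decode n (or_run E 0 C (replicate (3 ^ n) False))"
proof -
  let ?z = "replicate (3 ^ n) False"
  have len: "length (noisy_run F 0 C ?z) = 3 ^ n"
    using C length_noisy_run[of ?z C] by simp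
  have "decode n (noisy_run F 0 C ?z)"
  proof (cases b)
    case True
    have "noisy_run F 0 C (map Not ?z) = map Not (noisy_run F 0 C ?z)"
      using C by (intro noisy_run_Not) simp
    then show ?thesis
      using err True len by (simp add: decode_Not)
  qed (use err in simp)
  moreover have "noisy_run F 0 C ?z \<sqsubseteq> or_run E 0 C ?z"
    using C \<open>F \<subseteq> E\<close> by (intro noisy_run_le_or_run) (auto simp: list_all2_conv_all_nth)
  ultimately show ?thesis
    using decode_mono len by blast
qed

text \<open>One level replaces \<open>p\<close> by \<open>(1025 * p)\<^sup>2\<close>. Multiplied by
  \<open>1025\<^sup>2\<close>, the parameter is simply squared at each level, which gives the closed
  form. The map \<open>f\<close> composes the reductions of all levels.\<close>

lemma idle_reduction:
  fixes p :: real
  assumes PQ: "transposition_circuit P" "transposition_circuit Q" and T: "1 \<le> T"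
    and "0 \<le> p" "bounded_wire_errors p (FT_pow P Q n (idle_circuit T)) \<E>"
  shows "\<exists>f. bounded_wire_errors ((1025\<^sup>2 * p) ^ 2 ^ n / 1025\<^sup>2) (idle_circuit T) (map_pmf f \<E>) \<and>
    (\<forall>E. decode n (or_run E 0 (FT_pow P Q n (idle_circuit T)) (replicate (3 ^ n) False)) \<longrightarrow> f E \<noteq> {})"
  using assms(4,5)
proof (induction n arbitrary: p \<E>)
  case 0
  then show ?case
    by (intro exI[of _ id]) (auto simp: FT_pow_def or_run_no_noise_idle)
next
  case (Suc n)
  let ?C = "FT_pow P Q n (idle_circuit T)" and ?z = "replicate (3 ^ n) False"
  have C: "well_formed (3 ^ n) ?C"
    using PQ T by (rule well_formed_FT_pow_idle)
  have FT: "FT_pow P Q (Suc n) (idle_circuit T) = FT P Q ?C"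
    by (simp add: FT_pow_def)
  obtain N where N: "\<And>x. finite (N x) \<and> card (N x) \<le> 1025"
    and red: "\<And>E x. length x = 3 ^ n \<Longrightarrow> \<exists>E' \<subseteq> wires ?C. explained N E E' \<and>
      decode_blocks (Suc 0) (3 ^ n) (or_run E 0 (FT P Q ?C) (encode_blocks (Suc 0) x)) \<sqsubseteq> or_run E' 0 ?C x"
    using FT_reduction[OF PQ C] by (metis zero_less_power zero_less_numeral)
  obtain r where r: "\<And>E. r E \<subseteq> wires ?C" "\<And>E. explained N E (r E)"
    "\<And>E. decode_blocks (Suc 0) (3 ^ n) (or_run E 0 (FT P Q ?C) (encode_blocks (Suc 0) ?z)) \<sqsubseteq>
      or_run (r E) 0 ?C ?z"
    using red[of ?z] by (metis length_replicate)
  have "bounded_wire_errors ((real 1025 * p)\<^sup>2) ?C (map_pmf r \<E>)"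
    using Suc.prems N r(1,2) unfolding FT by (intro bounded_wire_errors_explained[where N = N])
  from Suc.IH[OF _ this] obtain f where
    f: "bounded_wire_errors ((1025\<^sup>2 * (real 1025 * p)\<^sup>2) ^ 2 ^ n / 1025\<^sup>2) (idle_circuit T) (map_pmf f (map_pmf r \<E>))"
      "\<And>E. decode n (or_run E 0 ?C ?z) \<Longrightarrow> f E \<noteq> {}"
    by auto
  have "(1025\<^sup>2 * (real 1025 * p)\<^sup>2) ^ 2 ^ n = (1025\<^sup>2 * p) ^ 2 ^ Suc n"
    by (simp add: power_mult power2_eq_square mult_ac)
  moreover have "f (r E) \<noteq> {}"
    if "decode (Suc n) (or_run E 0 (FT P Q ?C) (replicate (3 ^ Suc n) False))" for E
  proof (rule f(2))
    let ?s = "or_run E 0 (FT P Q ?C) (replicate (3 ^ Suc n) False)"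
    have "has_width (3 ^ Suc n) (FT P Q ?C)"
      using well_formed_FT[OF PQ C] by (simp add: well_formed_def has_width_def)
    then have "length ?s = 3 ^ Suc n"
      using length_or_run[of "replicate (3 ^ Suc n) False"] by simp
    then have "decode n (decode_blocks (Suc 0) (3 ^ n) ?s)"
      using that decode_Suc by blast
    moreover have "decode_blocks (Suc 0) (3 ^ n) ?s \<sqsubseteq> or_run (r E) 0 ?C ?z"
      using r(3)[of E] by (simp add: encode_blocks_replicate)
    ultimately show "decode n (or_run (r E) 0 ?C ?z)"
      using decode_mono[of "decode_blocks (Suc 0) (3 ^ n) ?s"] by simp
  qed
  ultimately show ?case
    using f(1) unfolding FT by (intro exI[of _ "\<lambda>E. f (r E)"]) (simp add: pmf.map_comp o_def)
qed

theorem theorem2p2: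
  fixes P Q :: circuit
  assumes "transposition_circuit P" and "transposition_circuit Q"
  shows "\<exists>A :: real. \<forall>(n :: nat) (T :: nat) (p :: real) (\<E> :: wire set pmf).
    1 \<le> T \<longrightarrow> 0 \<le> p \<longrightarrow> p \<le> 1 \<longrightarrow>
    bounded_wire_errors p (FT_pow P Q n (idle_circuit T)) \<E> \<longrightarrow>
      simulates P Q n (idle_circuit T) \<E> ((A * p) ^ (2 ^ n)) \<and>
      (\<forall>s0 \<in> {replicate (3 ^ n) False, replicate (3 ^ n) True}.
       \<forall>J :: (wire set \<times> bool list) pmf.
         map_pmf fst J = \<E> \<longrightarrow>
         (\<forall>(E, s) \<in> set_pmf J. s \<in> noisy_outputs (FT_pow P Q n (idle_circuit T)) E s0) \<longrightarrow>
         measure_pmf.prob J {(E, s). decode n s \<noteq> decode n s0} \<le> real T * (A * p) ^ (2 ^ n))"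
proof (intro exI[of _ "2 * 1025\<^sup>2"] allI impI)
  fix n T :: nat and p :: real and \<E> :: "wire set pmf"
  let ?C = "FT_pow P Q n (idle_circuit T)" and ?I = "idle_circuit T"
  let ?B = "1025\<^sup>2 :: real"
  \<comment> \<open>The factor 2 in the constant absorbs the number of wires: the idle circuit has
    \<open>T + 1 \<le> 2 * T\<close> of them, and \<open>2 * ?q \<le> ?q'\<close>.\<close>
  let ?q = "(?B * p) ^ 2 ^ n / ?B" and ?q' = "(2 * ?B * p) ^ 2 ^ n"
  assume T: "1 \<le> T" and p: "0 \<le> p" and \<E>: "bounded_wire_errors p ?C \<E>"
  obtain f where f: "bounded_wire_errors ?q ?I (map_pmf f \<E>)"
    "\<And>E. decode n (or_run E 0 ?C (replicate (3 ^ n) False)) \<Longrightarrow> f E \<noteq> {}"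
    using idle_reduction[OF assms T p \<E>] by blast
  have wC: "has_width (3 ^ n) ?C"
    using well_formed_FT_pow_idle[OF assms T] by (simp add: well_formed_def has_width_def)
  have wI: "width ?I = 1" "wires ?I = {0..T} \<times> {0}"
    using T by (auto simp: wires_def width_def idle_circuit_def)
  have q: "0 \<le> ?q" "2 * ?q \<le> ?q'"
  proof -
    show "0 \<le> ?q" using p by simp
    have "2 * ?q \<le> 2 * (?B * p) ^ 2 ^ n"
      using p by (simp add: divide_le_eq)
    also have "\<dots> \<le> 2 ^ 2 ^ n * (?B * p) ^ 2 ^ n"
      using p by (intro mult_right_mono) (simp_all add: self_le_power)
    also have "\<dots> = ?q'"
      by (simp only: power_mult_distrib mult.assoc)
    finally show "2 * ?q \<le> ?q'" .
  qed
  have err: "f E \<noteq> {}"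
    if "s \<in> noisy_outputs ?C E (replicate (3 ^ n) b)" "decode n s \<noteq> b" for E s b
    using that noisy_decode_error[OF wC] by (intro f(2)) (auto simp: noisy_outputs_def)
  show "simulates P Q n ?I \<E> ?q' \<and>
      (\<forall>s0 \<in> {replicate (3 ^ n) False, replicate (3 ^ n) True}.
       \<forall>J :: (wire set \<times> bool list) pmf.
         map_pmf fst J = \<E> \<longrightarrow>
         (\<forall>(E, s) \<in> set_pmf J. s \<in> noisy_outputs ?C E s0) \<longrightarrow>
         measure_pmf.prob J {(E, s). decode n s \<noteq> decode n s0} \<le> real T * ?q')"
  proof (intro conjI ballI allI impI)
    define J where "J = map_pmf (\<lambda>E. (E, f E)) \<E>"
    have "bounded_wire_errors ?q' ?I (map_pmf snd J)"
      using bounded_wire_errors_mono[OF f(1) q(1)] q by (simp add: J_def pmf.map_comp o_def)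
    moreover have "decode_blocks n (width ?I) s \<in> noisy_outputs ?I (f E) x"
      if E: "E \<in> set_pmf \<E>" and x: "length x = width ?I"
        and s: "s \<in> noisy_outputs ?C E (encode_blocks n x)" for E x s
    proof -
      obtain b where b: "x = [b]"
        using x wI(1) by (auto simp: length_Suc_conv)
      have enc: "encode_blocks n x = replicate (3 ^ n) b"
        by (simp add: b encode_blocks_def)
      then have "length s = 3 ^ n"
        using s length_noisy_run[of "replicate (3 ^ n) b" ?C] wC by (auto simp: noisy_outputs_def)
      then have dec: "decode_blocks n (width ?I) s = [decode n s]"
        by (simp add: decode_blocks_def wI(1))
      show ?thesis
      proof (cases "decode n s = b")
        case True
        then show ?thesis
          unfolding dec b noisy_outputs_def using noisy_run_no_noise_idle[of 0 T b] by (auto intro!: exI[of _ "{}"])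
      next
        case False
        \<comment> \<open>A decoding error forces \<open>f E\<close> to be nonempty. Flipping any
          one of its wires inverts the single bit, whatever the time of that wire, and so reproduces
          the error.\<close>
        with s have "f E \<noteq> {}"
          using err enc by simp
        moreover have "f E \<subseteq> wires ?I"
          using f(1) E by (simp add: bounded_wire_errors_def)
        moreover from \<open>f E \<noteq> {}\<close> obtain r k where "(r, k) \<in> f E"
          by (metis ex_in_conv surj_pair)
        ultimately have r: "r \<le> T" "{(r, 0)} \<subseteq> f E"
          by (auto simp: wI(2))
        then show ?thesis
          unfolding dec b noisy_outputs_def using noisy_run_single_error_idle[of r 0 T b] False
          by (auto intro!: exI[of _ "{(r, 0)}"])
      qed
    qed
    ultimately show "simulates P Q n ?I \<E> ?q'"
      unfolding simulates_def by (intro exI[of _ J]) (auto simp: J_def pmf.map_comp o_def)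
  next
    fix s0 and J :: "(wire set \<times> bool list) pmf"
    assume s0: "s0 \<in> {replicate (3 ^ n) False, replicate (3 ^ n) True}"
      and J: "map_pmf fst J = \<E>" "\<forall>(E, s) \<in> set_pmf J. s \<in> noisy_outputs ?C E s0"
    have "f E \<noteq> {}" if "(E, s) \<in> set_pmf J" "decode n s \<noteq> decode n s0" for E s
    proof (rule err)
      show "s \<in> noisy_outputs ?C E (replicate (3 ^ n) (decode n s0))"
        using s0 J(2) that(1) by (auto simp: decode_replicate)
    qed (rule that(2))
    \<comment> \<open>The failure event lies in one that depends on the fault set alone, so the way
      the flips are chosen no longer matters.\<close>
    then have "measure_pmf.prob J {(E, s). decode n s \<noteq> decode n s0} \<le> measure_pmf.prob J {x. f (fst x) \<noteq> {}}"
      by (intro measure_pmf.finite_measure_mono_AE) (auto simp: AE_measure_pmf_iff)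
    also have "\<dots> = measure_pmf.prob (map_pmf f \<E>) {E. E \<noteq> {}}"
      by (simp add: vimage_def flip: J(1))
    also have "\<dots> \<le> card (wires ?I) * ?q"
      by (rule bounded_wire_errors_nonempty[OF f(1)])
    also have "\<dots> \<le> (2 * real T) * ?q"
      using q(1) T by (intro mult_right_mono) (simp_all add: wI(2) card_cartesian_product)
    also have "\<dots> \<le> real T * ?q'"
      using mult_left_mono[OF q(2), of "real T"] by (simp add: mult_ac)
    finally show "measure_pmf.prob J {(E, s). decode n s \<noteq> decode n s0} \<le> real T * ?q'" .
  qed
qed

end
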